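(* Let $D$ be a link diagram with $c_-$ negative crossings such that its all-$A$ state graph $G_A(D)$ is planar and has girth $g$ of at least two. If $-c_-\leq i \leq -c_- + g-1$, then (for every $j\in\mathbb{Z}$) the integral odd Khovanov homology $Kh_{\text{odd}}^{i,j}(D)$ has no torsion.
   Context: State graph. Each crossing of a link diagram $D$ has an $A$-resolution and a $B$-resolution: the $A$-resolution joins the two regions swept out by rotating the over-strand counterclockwise to the under-strand, and the $B$-resolution joins the other two regions. (A crossing is positive/negative by the usual right-hand convention.) Resolving every crossing gives a collection of disjoint closed curves called a Kauffman state; each resolved crossing is recorded by a small line segment (its trace) joining the two resulting strands. The all-$A$ state uses the $A$-resolution at each crossing. The all-$A$ state graph $G_A(D)$ has one vertex for each component of the all-$A$ state and one edge for each crossing, joining the vertices of the components (possibly equal) which the trace connects. Loops and multiple edges are allowed. The girth of a graph is the length of its shortest cycle (a loop is a cycle of length 1, a pair of parallel edges a cycle of length 2), and is infinite if the graph is acyclic. Odd Khovanov homology (over $R=\mathbb{Z}$). Let $D$ have crossings $c_1,\dots,c_n$, of which $c_+$ are positive and $c_-$ negative. For $I=(k_1,\dots,k_n)\in\{0,1\}^n$ let $h(I)=\sum_r k_r$ and let $D(I)$ be the Kauffman state with an $A$-resolution at $c_r$ if $k_r=0$ and a $B$-resolution if $k_r=1$; $|D(I)|$ is its number of components. Let $V(D(I))$ be the free $R$-module on generators $X^I_1,\dots,X^I_{|D(I)|}$, one for each component of $D(I)$, and let $\Lambda^*(V(D(I)))$ be its exterior algebra, with $\Lambda^r(V(D(I)))$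 in bigrading $(0,|D(I)|-2r)$ (homological grading, polynomial grading). For a bigraded module put $(M[r]\{s\})^{i,j}=M^{i-r,j-s}$. Let $C_{\text{odd}}(D(I))=\Lambda^*(V(D(I)))[h(I)]\{h(I)\}$ and $CKh_{\text{odd}}(D)=\bigoplus_I C_{\text{odd}}(D(I))[-c_-]\{c_+-2c_-\}$. Choose an arbitrary orientation of each trace of the all-$A$ state; in other states the trace at an $A$-resolved crossing has the same orientation, and the trace at a $B$-resolved crossing has the orientation obtained by rotating the oriented $A$-trace at this crossing by $90^\circ$ clockwise. Let $\xi$ be a hypercube edge from $I$ to $J$ (one entry changes from $0$ to $1$). If two components of $D(I)$, with variables $X^I_{i_1},X^I_{i_2}$, are merged, let $m_{\text{odd}}$ be the composition $C_{\text{odd}}(D(I))\to C_{\text{odd}}(D(I))/(X^I_{i_1}-X^I_{i_2})\cong C_{\text{odd}}(D(J))$ of the canonical projection and the natural identification. If a component of $D(I)$ is split into components of $D(J)$ with variables $X^J_{i_1},X^J_{i_2}$, where the trace in $D(J)$ points from the component of $X^J_{i_1}$ to that of $X^J_{i_2}$, let $\Delta_{\text{odd}}(\omega)=(X^J_{i_1}-X^J_{i_2})\wedge\eta(\omega)$, where $\eta$ is the algebra map sending $X^I_k$ to the variable of the corresponding component of $D(J)$ (for the split component, either $X^J_{i_1}$ or $X^J_{i_2}$ may be used, with the same result). Each two-dimensional face of the cube of maps commutes or anti-commutes (or both). A sign assignment is a function $\epsilon$ from hypercube edges to $\{\pm1\}$ such that, after multiplying each edge map by $\epsilon(\xi)$,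 every square anti-commutes; Ozsváth, Rasmussen and Szabó proved that sign assignments exist and that the resulting homology does not depend on choices up to isomorphism. Then $d_{\text{odd}}=\sum_\xi d_\xi$, with $d_\xi=\epsilon(\xi)m_{\text{odd}}$ or $\epsilon(\xi)\Delta_{\text{odd}}$, is a differential of bidegree $(1,0)$, and $Kh^{i,j}_{\text{odd}}(D)$ is the homology of $(CKh_{\text{odd}}(D),d_{\text{odd}})$ in bigrading $(i,j)$. *)

theory Defs
  imports "HOL-Analysis.Analysis" "HOL-Algebra.Free_Abelian_Groups"
begin

section \<open>Multigraphs: girth and planarity\<close>

text \<open>The ends of an edge form a set with two elements, or with one element if the edge is a loop.\<close>

record ('v, 'e) multigraph =
  mg_verts :: "'v set"
  mg_edges :: "'e set"
  mg_ends  :: "'e \<Rightarrow> 'v set"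

definition mg_cycle :: "('v, 'e) multigraph \<Rightarrow> 'v list \<Rightarrow> 'e list \<Rightarrow> bool" where
  "mg_cycle G vs es \<longleftrightarrow>
     es \<noteq> [] \<and> length vs = length es \<and> distinct vs \<and> distinct es \<and>
     set vs \<subseteq> mg_verts G \<and> set es \<subseteq> mg_edges G \<and>
     (\<forall>i < length es. mg_ends G (es ! i) = {vs ! i, vs ! (Suc i mod length es)})"

text \<open>The infimum of the empty set of extended naturals is \<open>\<infinity>\<close>, the girth of an acyclic graph.\<close>

definition mg_girth :: "('v, 'e) multigraph \<Rightarrow> enat" where
  "mg_girth G = Inf {enat (length es) |vs es. mg_cycle G vs es}"

text \<open>
  Planarity is the existence of a drawing in the plane: vertices are distinct points, and edges are
  simple (for loops: simple closed) curves which meet the vertices and each other only in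
  endpoints.
\<close>

definition mg_planar :: "('v, 'e) multigraph \<Rightarrow> bool" where
  "mg_planar G \<longleftrightarrow>
     (\<exists>(pos :: 'v \<Rightarrow> complex) (\<gamma> :: 'e \<Rightarrow> real \<Rightarrow> complex).
        inj_on pos (mg_verts G) \<and>
        (\<forall>e \<in> mg_edges G.
           simple_path (\<gamma> e) \<and>
           {pathstart (\<gamma> e), pathfinish (\<gamma> e)} = pos ` mg_ends G e \<and>
           \<gamma> e ` {0<..<1} \<inter> pos ` mg_verts G = {}) \<and>
        (\<forall>e \<in> mg_edges G. \<forall>f \<in> mg_edges G. e \<noteq> f \<longrightarrow>
           \<gamma> e ` {0<..<1} \<inter> \<gamma> f ` {0<..<1} = {}))"


section \<open>Link diagrams\<close>

text \<open>
  Link diagrams are encoded as in planar diagram (PD) codes. Around each crossing \<open>r\<close> the four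
  half-edges are numbered \<open>0, 1, 2, 3\<close> counterclockwise, beginning with the incoming end of the
  under-strand; half-edge \<open>k\<close> at crossing \<open>r\<close> is the number \<open>4 * r + k\<close>. So \<open>0\<close> and \<open>2\<close> are the
  ends of the under-strand, with \<open>2\<close> the outgoing one, and \<open>1\<close> and \<open>3\<close> are the ends of the
  over-strand, which by the right-hand rule runs from \<open>3\<close> to \<open>1\<close> at a positive crossing and from
  \<open>1\<close> to \<open>3\<close> at a negative one. The involution \<open>opp\<close> exchanges the two half-edges of an edge of
  the diagram, and \<open>ncirc\<close> counts the closed curves of the diagram without crossings. How several
  connected components of a diagram are placed relative to each other is not recorded; neither the
  Kauffman states nor anything below depends on it.
\<close>

record link_diagram =
  ncross    :: nat
  pos_cross :: "nat \<Rightarrow> bool"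
  opp       :: "nat \<Rightarrow> nat"
  ncirc     :: nat

definition halfedges :: "link_diagram \<Rightarrow> nat set" where
  "halfedges D = {..<4 * ncross D}"

definition outgoing :: "link_diagram \<Rightarrow> nat \<Rightarrow> bool" where
  "outgoing D p \<longleftrightarrow> p mod 4 = 2 \<or> p mod 4 = (if pos_cross D (p div 4) then 1 else 3)"

definition rot :: "nat \<Rightarrow> nat" where
  "rot p = 4 * (p div 4) + Suc (p mod 4) mod 4"

text \<open>The classes of \<open>A\<close> under the equivalence relation generated by \<open>P\<close>\<close>

definition gen_classes :: "nat set \<Rightarrow> (nat \<Rightarrow> nat \<Rightarrow> bool) \<Rightarrow> nat set set" where
  "gen_classes A P = A // {(p, q). p \<in> A \<and> q \<in> A \<and> (P p q \<or> P q p)}\<^sup>*"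

text \<open>The faces of a cellularly embedded graph, traced along their boundaries\<close>

definition faces :: "link_diagram \<Rightarrow> nat set set" where
  "faces D = gen_classes (halfedges D) (\<lambda>p q. q = rot (opp D p))"

definition conn_components :: "link_diagram \<Rightarrow> nat set set" where
  "conn_components D = gen_classes (halfedges D) (\<lambda>p q. q = opp D p \<or> q div 4 = p div 4)"

text \<open>
  The last condition says that the diagram lies in the plane (equivalently, on the sphere): with
  \<open>ncross D\<close> vertices and \<open>2 * ncross D\<close> edges, it is Euler's formula \<open>V - E + F = 2\<close> summed over
  the connected components, each of which contributes at most \<open>2\<close>.
\<close>

definition is_link_diagram :: "link_diagram \<Rightarrow> bool" where
  "is_link_diagram D \<longleftrightarrow>
     (\<forall>p \<in> halfedges D. opp D p \<in> halfedges D \<and> opp D (opp D p) = p \<and>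
        (outgoing D (opp D p) \<longleftrightarrow> \<not> outgoing D p)) \<and>
     int (ncross D) - int (2 * ncross D) + int (card (faces D)) = 2 * int (card (conn_components D))"

definition c_plus :: "link_diagram \<Rightarrow> nat" where
  "c_plus D = card {r. r < ncross D \<and> pos_cross D r}"

definition c_minus :: "link_diagram \<Rightarrow> nat" where
  "c_minus D = card {r. r < ncross D \<and> \<not> pos_cross D r}"


section \<open>Kauffman states\<close>

text \<open>
  A vertex \<open>I\<close> of the hypercube is given by the set of the crossings with a B-resolution. Rotating
  the over-strand (ends \<open>1\<close> and \<open>3\<close>) counterclockwise to the under-strand sweeps out the corners
  between \<open>1, 2\<close> and between \<open>3, 0\<close>. The A-resolution joins these two corners, so its strands
  connect \<open>0\<close> with \<open>1\<close> and \<open>2\<close> with \<open>3\<close>; the strands of the B-resolution connect \<open>0\<close> with \<open>3\<close>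
  and \<open>1\<close> with \<open>2\<close>.
\<close>

definition smooth :: "nat set \<Rightarrow> nat \<Rightarrow> nat" where
  "smooth I p =
     (let r = p div 4; k = p mod 4
      in 4 * r + (if r \<in> I then 3 - k else if even k then k + 1 else k - 1))"

definition state_rel :: "link_diagram \<Rightarrow> nat set \<Rightarrow> (nat \<times> nat) set" where
  "state_rel D I = {(p, q). p \<in> halfedges D \<and> q \<in> halfedges D \<and> (q = opp D p \<or> q = smooth I p)}"

text \<open>
  A component of the state \<open>D(I)\<close> is named by its least half-edge. The components without
  crossings are named by the \<open>ncirc D\<close> numbers after the half-edges.
\<close>

definition component :: "link_diagram \<Rightarrow> nat set \<Rightarrow> nat \<Rightarrow> nat" where
  "component D I p = (LEAST q. (p, q) \<in> (state_rel D I)\<^sup>*)"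

definition components :: "link_diagram \<Rightarrow> nat set \<Rightarrow> nat set" where
  "components D I = component D I ` {..<4 * ncross D + ncirc D}"

text \<open>
  In both resolutions of a crossing the half-edges \<open>0\<close> and \<open>2\<close> belong to different strands, so
  the trace connects the components of these two half-edges.
\<close>

definition state_graph_A :: "link_diagram \<Rightarrow> (nat, nat) multigraph" where
  "state_graph_A D =
     \<lparr> mg_verts = components D {},
       mg_edges = {..<ncross D},
       mg_ends = (\<lambda>r. {component D {} (4 * r), component D {} (4 * r + 2)}) \<rparr>"


section \<open>Exterior algebras\<close>

text \<open>
  The exterior algebra of the free abelian group on a finite set \<open>B\<close> of generators is the free
  abelian group on the monomials \<open>X\<^sub>S = X\<^sub>s\<^sub>1 \<and> \<dots> \<and> X\<^sub>s\<^sub>r\<close> with \<open>S = {s\<^sub>1 < \<dots> < s\<^sub>r} \<subseteq> B\<close>; the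
  monomial \<open>X\<^sub>S\<close> is represented by the set \<open>S\<close>.
\<close>

type_synonym ext = "nat set \<Rightarrow>\<^sub>0 int"

definition ext_carrier :: "nat set \<Rightarrow> ext set" where
  "ext_carrier B = carrier (free_Abelian_group (Pow B))"

definition ext_var :: "nat \<Rightarrow> ext" where
  "ext_var a = frag_of {a}"

text \<open>The exponent counts the transpositions needed to sort the factors of \<open>X\<^sub>S \<and> X\<^sub>T\<close>.\<close>

definition ext_wedge_monom :: "nat set \<Rightarrow> nat set \<Rightarrow> ext" where
  "ext_wedge_monom S T =
     (if S \<inter> T = {} then frag_cmul ((-1) ^ card {(s, t). s \<in> S \<and> t \<in> T \<and> t < s}) (frag_of (S \<union> T))
      else 0)"

definition ext_wedge :: "ext \<Rightarrow> ext \<Rightarrow> ext" where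
  "ext_wedge x y = frag_extend (\<lambda>S. frag_extend (\<lambda>T. ext_wedge_monom S T) y) x"

text \<open>The algebra homomorphism sending each \<open>X\<^sub>a\<close> to \<open>X\<^bsub>\<phi> a\<^esub>\<close>\<close>

definition ext_map :: "(nat \<Rightarrow> nat) \<Rightarrow> ext \<Rightarrow> ext" where
  "ext_map \<phi> =
     frag_extend (\<lambda>S. foldr (\<lambda>a. ext_wedge (ext_var (\<phi> a))) (sorted_list_of_set S) (frag_of {}))"


section \<open>The odd Khovanov complex\<close>

text \<open>
  The parameter \<open>tr\<close> chooses the orientations of the traces of the all-A state: if \<open>tr r\<close> holds,
  the A-trace at crossing \<open>r\<close> points from the strand through the half-edges \<open>0, 1\<close> to that through
  \<open>2, 3\<close>, otherwise in the opposite direction. The \<open>90\<close> degree clockwise rotation takes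
  half-edge \<open>k\<close> to half-edge \<open>k - 1\<close> (modulo \<open>4\<close>), so that the B-trace points from the strand
  through \<open>3, 0\<close> to that through \<open>1, 2\<close> if \<open>tr r\<close> holds, and in the opposite direction otherwise.
\<close>

definition trace_source :: "(nat \<Rightarrow> bool) \<Rightarrow> nat \<Rightarrow> nat" where
  "trace_source tr r = (if tr r then 4 * r else 4 * r + 2)"

definition trace_target :: "(nat \<Rightarrow> bool) \<Rightarrow> nat \<Rightarrow> nat" where
  "trace_target tr r = (if tr r then 4 * r + 2 else 4 * r)"

text \<open>
  The unsigned map along the hypercube edge from \<open>I\<close> to \<open>J = insert r I\<close>. As components are named
  by half-edges (or crossingless curves), \<open>component D J\<close> sends a component of \<open>D(I)\<close> to the
  corresponding component of \<open>D(J)\<close>; a component that is split goes to one of its two parts. For a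
  merge, the induced map is the projection which identifies the two variables, followed by the
  natural identification.
\<close>

definition edge_map :: "link_diagram \<Rightarrow> (nat \<Rightarrow> bool) \<Rightarrow> nat set \<Rightarrow> nat \<Rightarrow> ext \<Rightarrow> ext" where
  "edge_map D tr I r \<omega> =
     (let J = insert r I; \<eta> = ext_map (component D J)
      in if component D I (4 * r) \<noteq> component D I (4 * r + 2) then \<eta> \<omega>
         else ext_wedge (ext_var (component D J (trace_source tr r))
                         - ext_var (component D J (trace_target tr r))) (\<eta> \<omega>))"

definition is_sign_assignment ::
  "link_diagram \<Rightarrow> (nat \<Rightarrow> bool) \<Rightarrow> (nat set \<Rightarrow> nat \<Rightarrow> int) \<Rightarrow> bool" where
  "is_sign_assignment D tr \<epsilon> \<longleftrightarrow>
     (\<forall>I r. I \<subseteq> {..<ncross D} \<and> r \<in> {..<ncross D} - I \<longrightarrow> \<epsilon> I r \<in> {1, -1}) \<and>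
     (\<forall>I r s. I \<subseteq> {..<ncross D} \<and> r \<in> {..<ncross D} - I \<and> s \<in> {..<ncross D} - I \<and> r \<noteq> s \<longrightarrow>
        (\<forall>\<omega> \<in> ext_carrier (components D I).
           frag_cmul (\<epsilon> (insert r I) s * \<epsilon> I r) (edge_map D tr (insert r I) s (edge_map D tr I r \<omega>)) =
           - frag_cmul (\<epsilon> (insert s I) r * \<epsilon> I s) (edge_map D tr (insert s I) r (edge_map D tr I s \<omega>))))"

text \<open>
  The complex is the free abelian group on the pairs \<open>(I, S)\<close>, where \<open>S\<close> is a monomial of the
  exterior algebra of the state \<open>D(I)\<close>.
\<close>

type_synonym chain = "(nat set \<times> nat set) \<Rightarrow>\<^sub>0 int"

definition hdeg :: "link_diagram \<Rightarrow> nat set \<Rightarrow> int" where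
  "hdeg D I = int (card I) - int (c_minus D)"

definition qdeg :: "link_diagram \<Rightarrow> nat set \<Rightarrow> nat set \<Rightarrow> int" where
  "qdeg D I S = int (card (components D I)) - 2 * int (card S) + int (card I)
     + int (c_plus D) - 2 * int (c_minus D)"

definition CKh_odd :: "link_diagram \<Rightarrow> int \<Rightarrow> int \<Rightarrow> chain monoid" where
  "CKh_odd D i j = free_Abelian_group
     {(I, S). I \<subseteq> {..<ncross D} \<and> S \<subseteq> components D I \<and> hdeg D I = i \<and> qdeg D I S = j}"

text \<open>The inclusion of the summand at the vertex \<open>J\<close> into the complex\<close>

definition at_vertex :: "nat set \<Rightarrow> ext \<Rightarrow> chain" where
  "at_vertex J = frag_extend (\<lambda>S. frag_of (J, S))"

definition d_odd ::
  "link_diagram \<Rightarrow> (nat \<Rightarrow> bool) \<Rightarrow> (nat set \<Rightarrow> nat \<Rightarrow> int) \<Rightarrow> chain \<Rightarrow> chain" where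
  "d_odd D tr \<epsilon> = frag_extend (\<lambda>(I, S).
     \<Sum>r \<in> {..<ncross D} - I.
       frag_cmul (\<epsilon> I r) (at_vertex (insert r I) (edge_map D tr I r (frag_of S))))"

definition Kh_odd ::
  "link_diagram \<Rightarrow> (nat \<Rightarrow> bool) \<Rightarrow> (nat set \<Rightarrow> nat \<Rightarrow> int) \<Rightarrow> int \<Rightarrow> int \<Rightarrow> chain set monoid" where
  "Kh_odd D tr \<epsilon> i j =
     (CKh_odd D i j) \<lparr> carrier := {c \<in> carrier (CKh_odd D i j). d_odd D tr \<epsilon> c = 0} \<rparr>
     Mod (d_odd D tr \<epsilon> ` carrier (CKh_odd D (i - 1) j))"

definition torsion_free :: "('a, 'b) monoid_scheme \<Rightarrow> bool" where
  "torsion_free G \<longleftrightarrow>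
     (\<forall>x \<in> carrier G. \<forall>m::nat. 0 < m \<and> x [^]\<^bsub>G\<^esub> m = \<one>\<^bsub>G\<^esub> \<longrightarrow> x = \<one>\<^bsub>G\<^esub>)"

end

theory Submission
  imports Defs
begin

text \<open>
  Since the chain groups are free, the torsion of \<open>Kh\<^sup>i\<close> is that of the cokernel of the incoming
  differential. In the given range this differential only involves states \<open>D(I)\<close> where the edges
  in \<open>I\<close> form a forest in the state graph, and all its components are merges. Let \<open>\<Lambda>\<close> be the
  exterior algebra on the vertices and \<open>x\<^sub>e \<in> \<Lambda>\<close> the difference of the ends of the edge \<open>e\<close>. Wedging
  with the product of the \<open>x\<^sub>e\<close> for \<open>e \<in> I\<close> embeds the exterior algebra of \<open>D(I)\<close> into \<open>\<Lambda>\<close>, with image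
  the common annihilator of these \<open>x\<^sub>e\<close>, and turns the edge maps into \<open>\<plusminus> x\<^sub>r \<and> _\<close>; the signs can be
  absorbed into the embeddings. So the differential becomes \<open>(d b)\<^sub>N = \<Sum>\<^bsub>e \<in> N\<^esub> x\<^sub>e \<and> b\<^bsub>N - {e}\<^esub>\<close>, and the
  claim is that \<open>m c = d b\<close> with \<open>m > 0\<close> implies \<open>c = d a\<close> for some \<open>a\<close>.

  This is shown by deletion and contraction of an edge \<open>e\<close>. If \<open>e\<close> joins different components of the
  remaining graph, then a contraction operator inverts \<open>x\<^sub>e \<and> _\<close> on its kernel. Otherwise \<open>x\<^sub>e\<close> is a
  combination of the other \<open>x\<^sub>t\<close>, and below the girth it maps cycles of the deletion to boundaries of
  the contraction, so that the induction hypothesis for the contraction applies.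
\<close>

section \<open>Saturated images for anticommuting operators\<close>

lemma frag_cmul_uminus: "frag_cmul k (- a) = frag_cmul (- k) a"
  by (simp add: poly_mapping_eqI)

lemma frag_cmul_diff: "frag_cmul k (a - b) = frag_cmul k a - frag_cmul k b"
  by (simp add: poly_mapping_eqI lookup_minus right_diff_distrib)

text \<open>In the exterior algebra, interior product with a functional that is 1 on
  \<open>x\<^sub>e\<close> and 0 on every \<open>x\<^sub>f\<close> with f in \<open>F\<close> has
  these properties. It certifies that \<open>x\<^sub>e\<close> is independent of the
  \<open>x\<^sub>f\<close> and splits \<open>x e\<close> on its kernel.\<close>

definition contraction :: "('e \<Rightarrow> ('b \<Rightarrow>\<^sub>0 int) \<Rightarrow> ('b \<Rightarrow>\<^sub>0 int)) \<Rightarrow> 'e \<Rightarrow> 'e set \<Rightarrow>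
    (('b \<Rightarrow>\<^sub>0 int) \<Rightarrow> ('b \<Rightarrow>\<^sub>0 int)) \<Rightarrow> bool" where
  "contraction x e F \<iota> \<longleftrightarrow> (\<forall>a b. \<iota> (a + b) = \<iota> a + \<iota> b) \<and>
     (\<forall>a. x e (\<iota> a) = a - \<iota> (x e a)) \<and> (\<forall>f\<in>F. \<forall>a. \<iota> (x f a) = - x f (\<iota> a))"

text \<open>This is what deletion and contraction need to know about the graph. Sets of fewer than
  \<open>g\<close> edges behave like forests, and every edge is either independent of a given set or
  an integral combination of it. That the coefficients are integers, not just rationals, is what
  excludes torsion.\<close>

locale anticommuting_operators =
  fixes E :: "'e set" and x :: "'e \<Rightarrow> ('b \<Rightarrow>\<^sub>0 int) \<Rightarrow> ('b \<Rightarrow>\<^sub>0 int)" and g :: enat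
  assumes finite_E: "finite E"
    and op_add: "x e (a + b) = x e a + x e b"
    and op_anticommute: "x e (x f a) = - x f (x e a)"
    and independent: "\<lbrakk>F \<subseteq> E; e \<in> E - F; enat (Suc (card F)) < g\<rbrakk> \<Longrightarrow> \<exists>\<iota>. contraction x e F \<iota>"
    and independent_or_spanned: "\<lbrakk>F \<subseteq> E; e \<in> E - F\<rbrakk> \<Longrightarrow>
      (\<exists>\<iota>. contraction x e F \<iota>) \<or>
      (\<exists>c. \<forall>a. x e a = (\<Sum>t\<in>F. frag_cmul (c t) (x t a)))"
begin

lemma op_zero [simp]: "x e 0 = 0"
  using op_add[of e 0 0] by simp

lemma op_minus: "x e (- a) = - x e a"
  using op_add[of e a "- a"] by (simp add: eq_neg_iff_add_eq_0 add.commute)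

lemma op_diff: "x e (a - b) = x e a - x e b"
  using op_add[of e a "- b"] by (simp add: op_minus)

lemma op_sum: "x e (sum f A) = (\<Sum>i\<in>A. x e (f i))"
  by (induction A rule: infinite_finite_induct) (simp_all add: op_add)

lemma op_cmul: "x e (frag_cmul k a) = frag_cmul k (x e a)"
proof -
  have "x e (frag_cmul (int n) a) = frag_cmul (int n) (x e a)" for n
    by (induction n) (simp_all add: frag_cmul_distrib op_add)
  then show ?thesis
    by (cases k rule: int_cases2) (simp_all add: op_minus flip: minus_frag_cmul)
qed

lemma op_square [simp]: "x e (x e a) = 0"
proof -
  \<comment> \<open>Anticommuting with itself only makes twice the square vanish; chains are free
    over the integers, so the factor 2 can be cancelled.\<close>
  have "frag_cmul 2 (x e (x e a)) = x e (x e a) + x e (x e a)"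
    using frag_cmul_distrib[of 1 1] by simp
  also have "\<dots> = 0"
    using op_anticommute[of e e a] by (metis add.right_inverse)
  finally show ?thesis by simp
qed

definition ann :: "'e set \<Rightarrow> ('b \<Rightarrow>\<^sub>0 int) set" where
  "ann T = {a. \<forall>f\<in>T. x f a = 0}"

lemma annD: "\<lbrakk>a \<in> ann T; f \<in> T\<rbrakk> \<Longrightarrow> x f a = 0"
  by (simp add: ann_def)

lemma ann_zero [simp]: "0 \<in> ann T"
  and ann_add: "\<lbrakk>a \<in> ann T; b \<in> ann T\<rbrakk> \<Longrightarrow> a + b \<in> ann T"
  and ann_diff: "\<lbrakk>a \<in> ann T; b \<in> ann T\<rbrakk> \<Longrightarrow> a - b \<in> ann T"
  and ann_cmul: "a \<in> ann T \<Longrightarrow> frag_cmul k a \<in> ann T"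
  and ann_op: "a \<in> ann T \<Longrightarrow> x e a \<in> ann (insert e T)"
  by (auto simp: ann_def op_add op_diff op_minus op_cmul op_anticommute[of _ e])

lemma ann_sum: "(\<And>i. i \<in> I \<Longrightarrow> f i \<in> ann T) \<Longrightarrow> sum f I \<in> ann T"
  by (auto simp: ann_def op_sum intro!: sum.neutral)

lemma ann_mono: "\<lbrakk>a \<in> ann T; U \<subseteq> T\<rbrakk> \<Longrightarrow> a \<in> ann U"
  by (auto simp: ann_def)

section \<open>The codifferential of the cube of annihilators\<close>

definition codiff :: "('e set \<Rightarrow> ('b \<Rightarrow>\<^sub>0 int)) \<Rightarrow> 'e set \<Rightarrow> ('b \<Rightarrow>\<^sub>0 int)" where
  "codiff b N = (\<Sum>e\<in>N. x e (b (N - {e})))"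

lemma codiff_cong: "(\<And>e. e \<in> N \<Longrightarrow> a (N - {e}) = b (N - {e})) \<Longrightarrow> codiff a N = codiff b N"
  by (simp add: codiff_def)

lemma codiff_add: "codiff (\<lambda>F. a F + b F) N = codiff a N + codiff b N"
  and codiff_diff: "codiff (\<lambda>F. a F - b F) N = codiff a N - codiff b N"
  and codiff_cmul: "codiff (\<lambda>F. frag_cmul k (a F)) N = frag_cmul k (codiff a N)"
  and codiff_op: "codiff (\<lambda>F. x e (a F)) N = - x e (codiff a N)"
  by (simp_all add: codiff_def op_add op_diff op_minus op_cmul op_sum sum.distrib sum_subtractf
      sum_negf frag_cmul_sum op_anticommute[of _ e])

text \<open>The set \<open>S\<close> holds the edges that have already been contracted. Each summand
  is killed by its own \<open>x e\<close> because squares vanish, and by the other operators because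
  they anticommute with \<open>x e\<close>.\<close>

lemma codiff_ann:
  assumes "\<And>e. e \<in> N \<Longrightarrow> b (N - {e}) \<in> ann (N - {e} \<union> S)"
  shows "codiff b N \<in> ann (N \<union> S)"
  unfolding codiff_def
proof (rule ann_sum)
  fix e assume "e \<in> N"
  then show "x e (b (N - {e})) \<in> ann (N \<union> S)"
    by (rule ann_mono[OF ann_op[OF assms]]) auto
qed

text \<open>The complex is the mapping cone of \<open>x e\<close> from the deletion of
  \<open>e\<close> (sets avoiding \<open>e\<close>) to its contraction (sets containing
  \<open>e\<close>).\<close>

lemma codiff_insert:
  assumes "finite N" "e \<notin> N"
  shows "codiff b (insert e N) = x e (b N) + codiff (\<lambda>F. b (insert e F)) N"
proof -
  have "insert e N - {f} = insert e (N - {f})" if "f \<in> N" for f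
    using that assms by auto
  then show ?thesis
    using assms by (simp add: codiff_def)
qed

text \<open>By the cone decomposition, the two mixed terms are \<open>x e\<close> applied to
  \<open>codiff b N\<close> with opposite signs, the minus coming from \<open>codiff_op\<close>. No
  alternating signs are built into \<open>codiff\<close> since the operators anticommute.\<close>

lemma codiff_codiff: "finite N \<Longrightarrow> codiff (codiff b) N = 0"
proof (induction N arbitrary: b rule: finite_induct)
  case (insert e N)
  have "codiff (\<lambda>F. codiff b (insert e F)) N
      = codiff (\<lambda>F. x e (b F) + codiff (\<lambda>F. b (insert e F)) F) N"
    by (rule codiff_cong) (use insert in \<open>auto simp: codiff_insert\<close>)
  then show ?case
    using insert by (simp add: codiff_insert codiff_add codiff_op)
qed (simp add: codiff_def)

text \<open>
  Divided powers of the contraction along \<open>\<Sum>\<^sub>t c\<^sub>t x\<^sub>t\<close>. The first of them is a null-homotopy for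
  this operator, except that its values need not be annihilated by the operator.
\<close>

definition div_power :: "'e set \<Rightarrow> ('e \<Rightarrow> int) \<Rightarrow> ('e set \<Rightarrow> ('b \<Rightarrow>\<^sub>0 int)) \<Rightarrow> nat \<Rightarrow> 'e set \<Rightarrow> ('b \<Rightarrow>\<^sub>0 int)"
  where "div_power P c z i F =
    (\<Sum>Q | Q \<subseteq> P - F \<and> card Q = i. frag_cmul (prod c Q) (z (F \<union> Q)))"

lemma div_power_zero: "finite P \<Longrightarrow> div_power P c z 0 F = z F"
proof -
  assume "finite P"
  then have "finite Q" if "Q \<subseteq> P - F" for Q
    using that by (auto dest: finite_subset)
  then have "{Q. Q \<subseteq> P - F \<and> card Q = 0} = {{}}"
    by auto
  then show ?thesis
    by (simp add: div_power_def)
qed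

lemma div_power_ann:
  assumes "\<And>Q. \<lbrakk>Q \<subseteq> P - F; card Q = i\<rbrakk> \<Longrightarrow> z (F \<union> Q) \<in> ann (F \<union> Q \<union> S)"
  shows "div_power P c z i F \<in> ann (F \<union> S)"
  unfolding div_power_def
  by (rule ann_sum, rule ann_cmul) (use assms in \<open>auto intro: ann_mono\<close>)

text \<open>Expanding \<open>x e\<close> by its coefficients produces pairs of a set Q and a further
  element t, that is, sets R of size i + 1 with a marked element. The cycle condition on F together
  with R trades the marked elements of R for elements of F. Each R carries the weight
  \<open>prod c R\<close> once, so no factor i + 1 has to be divided out.\<close>

lemma op_div_power:
  assumes P: "finite P" and F: "F \<subseteq> P" "card F + i = j"
    and z: "\<And>F. \<lbrakk>F \<subseteq> P; card F = j\<rbrakk> \<Longrightarrow> z F \<in> ann (F \<union> S)"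
    and dz: "\<And>N. \<lbrakk>N \<subseteq> P; card N = Suc j\<rbrakk> \<Longrightarrow> codiff z N = 0"
    and xe: "\<And>a. a \<in> ann S \<Longrightarrow> x e a = (\<Sum>t\<in>P. frag_cmul (c t) (x t a))"
  shows "x e (div_power P c z i F) = - codiff (div_power P c z (Suc i)) F"
proof -
  have finF: "finite F" using P F(1) finite_subset by blast
  have cardU: "card (F \<union> Q) = card F + card Q" if "Q \<subseteq> P - F" for Q
    using that P finF by (intro card_Un_disjoint) (auto dest: finite_subset)
  let ?Q = "\<lambda>i. {Q. Q \<subseteq> P - F \<and> card Q = i}"
  have finQ: "finite (?Q i)" for i
    using P by (auto intro: finite_subset[of _ "Pow P"])
  have "x e (div_power P c z i F)
      = (\<Sum>Q\<in>?Q i. frag_cmul (prod c Q) (\<Sum>t\<in>P. frag_cmul (c t) (x t (z (F \<union> Q)))))"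
    unfolding div_power_def op_sum op_cmul
  proof (rule sum.cong, simp)
    fix Q assume Q: "Q \<in> ?Q i"
    then have "z (F \<union> Q) \<in> ann (F \<union> Q \<union> S)"
      using F cardU by (intro z) auto
    then show "frag_cmul (prod c Q) (x e (z (F \<union> Q)))
      = frag_cmul (prod c Q) (\<Sum>t\<in>P. frag_cmul (c t) (x t (z (F \<union> Q))))"
      by (subst xe) (auto intro: ann_mono)
  qed
  \<comment> \<open>Terms with t in F or Q vanish because z at the union of F and Q is annihilated
    by \<open>x t\<close>.\<close>
  also have "\<dots> = (\<Sum>Q\<in>?Q i. \<Sum>t\<in>P - F - Q. frag_cmul (prod c (insert t Q)) (x t (z (F \<union> Q))))"
  proof (rule sum.cong, simp)
    fix Q assume Q: "Q \<in> ?Q i"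
    then have zQ: "z (F \<union> Q) \<in> ann (F \<union> Q \<union> S)"
      using F cardU by (intro z) auto
    have finQ: "finite Q" using Q P by (auto dest: finite_subset)
    have "(\<Sum>t\<in>P. frag_cmul (c t) (x t (z (F \<union> Q))))
        = (\<Sum>t\<in>P - F - Q. frag_cmul (c t) (x t (z (F \<union> Q))))"
      using P annD[OF zQ] by (intro sum.mono_neutral_right) auto
    then show "frag_cmul (prod c Q) (\<Sum>t\<in>P. frag_cmul (c t) (x t (z (F \<union> Q))))
       = (\<Sum>t\<in>P - F - Q. frag_cmul (prod c (insert t Q)) (x t (z (F \<union> Q))))"
      using finQ by (simp add: frag_cmul_sum mult.commute)
  qed
  also have "\<dots> = (\<Sum>(Q, t)\<in>Sigma (?Q i) (\<lambda>Q. P - F - Q).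
      frag_cmul (prod c (insert t Q)) (x t (z (F \<union> Q))))"
    using P finQ by (intro sum.Sigma) auto
  also have "\<dots> = (\<Sum>(R, t)\<in>Sigma (?Q (Suc i)) (\<lambda>R. R).
      frag_cmul (prod c R) (x t (z (F \<union> R - {t}))))"
  proof (rule sum.reindex_bij_witness[where j = "\<lambda>(Q, t). (insert t Q, t)" and i = "\<lambda>(R, t). (R - {t}, t)"],
         goal_cases)
    case (3 a)
    then obtain R t where a: "a = (R, t)" "R \<subseteq> P - F" "card R = Suc i" "t \<in> R" by auto
    then have "card (R - {t}) = i" by simp
    with a show ?case by auto
  next
    case (5 a)
    then obtain Q t where a: "a = (Q, t)" "Q \<subseteq> P - F" "card Q = i" "t \<in> P - F - Q" by auto
    then have "finite Q" using P by (auto dest: finite_subset)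
    with a show ?case by (auto simp: card_insert_if)
  qed (auto dest: finite_subset simp: insert_absorb P finite_subset[of _ P] intro!: arg_cong[where f = z] arg_cong[where f = "x _"])
  also have "\<dots> = (\<Sum>R\<in>?Q (Suc i). \<Sum>t\<in>R. frag_cmul (prod c R) (x t (z (F \<union> R - {t}))))"
    using P finQ by (intro sum.Sigma[symmetric]) (auto dest: finite_subset)
  also have "\<dots> = (\<Sum>R\<in>?Q (Suc i). - (\<Sum>f\<in>F. frag_cmul (prod c R) (x f (z (F - {f} \<union> R)))))"
  proof (rule sum.cong, simp)
    fix R assume R: "R \<in> ?Q (Suc i)"
    have finR: "finite R" using R P by (auto dest: finite_subset)
    \<comment> \<open>The union of F and R has j + 1 elements, so z satisfies the cycle condition
      there.\<close>
    have "0 = codiff z (F \<union> R)"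
      using R F cardU by (intro dz[symmetric]) auto
    also have "\<dots> = (\<Sum>t\<in>F. x t (z (F \<union> R - {t}))) + (\<Sum>t\<in>R. x t (z (F \<union> R - {t})))"
      unfolding codiff_def using finF finR R by (intro sum.union_disjoint) auto
    also have "(\<Sum>t\<in>F. x t (z (F \<union> R - {t}))) = (\<Sum>t\<in>F. x t (z (F - {t} \<union> R)))"
      using R by (intro sum.cong refl arg_cong[where f = "x _"] arg_cong[where f = z]) auto
    finally have "(\<Sum>t\<in>R. x t (z (F \<union> R - {t}))) = - (\<Sum>t\<in>F. x t (z (F - {t} \<union> R)))"
      by (simp add: eq_neg_iff_add_eq_0 add.commute)
    then show "(\<Sum>t\<in>R. frag_cmul (prod c R) (x t (z (F \<union> R - {t}))))
        = - (\<Sum>f\<in>F. frag_cmul (prod c R) (x f (z (F - {f} \<union> R))))"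
      by (simp only: frag_cmul_sum[symmetric] frag_cmul_uminus minus_frag_cmul)
  qed
  also have "\<dots> = - (\<Sum>f\<in>F. \<Sum>R\<in>?Q (Suc i). frag_cmul (prod c R) (x f (z (F - {f} \<union> R))))"
    by (subst sum.swap) (simp add: sum_negf)
  also have "\<dots> = - codiff (div_power P c z (Suc i)) F"
    unfolding codiff_def div_power_def op_sum op_cmul
  proof (rule arg_cong[where f = uminus], rule sum.cong, simp, rule sum.mono_neutral_left)
    fix f assume f: "f \<in> F"
    show "finite {Q. Q \<subseteq> P - (F - {f}) \<and> card Q = Suc i}"
      using P by (auto intro: finite_subset[of _ "Pow P"])
    \<comment> \<open>The divided power at \<open>F - {f}\<close> also ranges over sets R containing
      f; those summands are killed by \<open>x f\<close>.\<close>
    show "\<forall>R \<in> {Q. Q \<subseteq> P - (F - {f}) \<and> card Q = Suc i} - ?Q (Suc i).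
      frag_cmul (prod c R) (x f (z (F - {f} \<union> R))) = 0"
    proof
      fix R assume R: "R \<in> {Q. Q \<subseteq> P - (F - {f}) \<and> card Q = Suc i} - ?Q (Suc i)"
      then have fR: "f \<in> R" by auto
      have "card (F - {f} \<union> R) = card (F - {f}) + card R"
        using R finF P by (intro card_Un_disjoint) (auto dest: finite_subset)
      also have "card (F - {f}) = card F - 1" using f finF by simp
      finally have "card (F - {f} \<union> R) = card F - 1 + card R" .
      moreover have "card F > 0" using f finF by (auto simp: card_gt_0_iff)
      moreover have "card R = Suc i" using R by simp
      ultimately have "card (F - {f} \<union> R) = j"
        using F(2) by linarith
      then have "z (F - {f} \<union> R) \<in> ann (F - {f} \<union> R \<union> S)"
        using R F by (intro z) auto
      then show "frag_cmul (prod c R) (x f (z (F - {f} \<union> R))) = 0"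
        using annD fR by simp
    qed
  qed auto
  finally show ?thesis .
qed

text \<open>The first divided power \<open>u 1\<close> gives
  \<open>x e (z N) = - codiff (u 1) N\<close>, but its values need not be annihilated by
  \<open>x e\<close>, as the contraction requires. Subtracting a coboundary does not change
  \<open>codiff (u 1)\<close>, and below the girth a suitable coboundary exists.\<close>

lemma op_null_homotopic:
  assumes P: "P \<subseteq> E" and S: "S \<subseteq> E" and e: "e \<in> E - (P \<union> S)"
    and j: "enat (Suc (j + card S)) < g"
    and z: "\<And>F. \<lbrakk>F \<subseteq> P; card F = j\<rbrakk> \<Longrightarrow> z F \<in> ann (F \<union> S)"
    and dz: "\<And>N. \<lbrakk>N \<subseteq> P; card N = Suc j\<rbrakk> \<Longrightarrow> codiff z N = 0"
    and xe: "\<And>a. a \<in> ann S \<Longrightarrow> x e a = (\<Sum>t\<in>P. frag_cmul (c t) (x t a))"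
  shows "\<exists>w. (\<forall>F. F \<subseteq> P \<longrightarrow> Suc (card F) = j \<longrightarrow> w F \<in> ann (insert e (F \<union> S))) \<and>
    (\<forall>N. N \<subseteq> P \<longrightarrow> card N = j \<longrightarrow> x e (z N) = codiff w N)"
proof -
  have finP: "finite P" using P finite_E finite_subset by blast
  have fin: "finite F" if "F \<subseteq> P" for F using that finP finite_subset by blast
  define u where "u = div_power P c z"
  have u_ann: "u i F \<in> ann (F \<union> S)" if "F \<subseteq> P" "card F + i = j" for F i
    unfolding u_def
  proof (rule div_power_ann, rule z)
    fix Q assume Q: "Q \<subseteq> P - F" "card Q = i"
    then show "F \<union> Q \<subseteq> P" using that by auto
    show "card (F \<union> Q) = j"
      using Q that fin[of F] fin[of Q] by (subst card_Un_disjoint) auto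
  qed
  have u_op: "x e (u i F) = - codiff (u (Suc i)) F" if "F \<subseteq> P" "card F + i = j" for F i
    unfolding u_def by (rule op_div_power[OF finP that z dz xe])
  \<comment> \<open>Descending recursion on i, starting at i = j. A correction v of
    \<open>u (i + 1)\<close> leaves something killed by \<open>x e\<close>, hence of the form
    \<open>x e y\<close>; these y form the correction of \<open>u i\<close>, since
    \<open>codiff\<close> of the first correction has zero codifferential.\<close>
  have descent: "\<exists>v. (\<forall>F. F \<subseteq> P \<longrightarrow> Suc (card F) + i = j \<longrightarrow> v F \<in> ann (F \<union> S)) \<and>
      (\<forall>F. F \<subseteq> P \<longrightarrow> card F + i = j \<longrightarrow> x e (u i F - codiff v F) = 0)" if "i + n = j" for i n
    using that
  proof (induction n arbitrary: i)
    case 0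
    have "x e (u i F - codiff (\<lambda>_. 0) F) = 0" if "F \<subseteq> P" "card F + i = j" for F
    proof -
      have "F = {}" using that 0 fin by simp
      then show ?thesis
        using u_op[OF that] by (simp add: codiff_def)
    qed
    then show ?case
      by (intro exI[of _ "\<lambda>_. 0"]) auto
  next
    case (Suc n)
    then obtain v where v: "\<And>F. \<lbrakk>F \<subseteq> P; Suc (card F) + Suc i = j\<rbrakk> \<Longrightarrow> v F \<in> ann (F \<union> S)"
      and v0: "\<And>F. \<lbrakk>F \<subseteq> P; card F + Suc i = j\<rbrakk> \<Longrightarrow> x e (u (Suc i) F - codiff v F) = 0"
      using Suc.IH[of "Suc i"] by auto
    \<comment> \<open>Since \<open>Suc (card F) \<le> j\<close>, the edges of F and S together with
      e number less than \<open>g\<close>. So a contraction \<open>\<iota>\<close> along e exists,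
      and y is the \<open>\<iota>\<close>-image of the element to be lifted.\<close>
    have "\<exists>y. y \<in> ann (F \<union> S) \<and> x e y = u (Suc i) F - codiff v F"
      if F: "F \<subseteq> P" "Suc (card F) + i = j" for F
    proof -
      have "card (F \<union> S) \<le> card F + card S" by (rule card_Un_le)
      then have "enat (Suc (card (F \<union> S))) \<le> enat (Suc (j + card S))"
        using F by simp
      then have "enat (Suc (card (F \<union> S))) < g" using j by (rule le_less_trans)
      moreover have "F \<union> S \<subseteq> E" "e \<in> E - (F \<union> S)" using F P S e by auto
      ultimately obtain \<iota> where "contraction x e (F \<union> S) \<iota>"
        using independent[of "F \<union> S" e] by blast
      then have \<iota>: "\<And>a b. \<iota> (a + b) = \<iota> a + \<iota> b" "\<And>a. x e (\<iota> a) = a - \<iota> (x e a)"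
        "\<And>f a. f \<in> F \<union> S \<Longrightarrow> \<iota> (x f a) = - x f (\<iota> a)"
        by (auto simp: contraction_def)
      have \<iota>0: "\<iota> 0 = 0" using \<iota>(1)[of 0 0] by simp
      let ?y = "u (Suc i) F - codiff v F"
      have "codiff v F \<in> ann (F \<union> S)"
      proof (rule codiff_ann)
        fix f assume "f \<in> F"
        then show "v (F - {f}) \<in> ann (F - {f} \<union> S)"
          using F fin[OF F(1)] by (intro v) (auto simp: card_Suc_Diff1 simp del: card_Diff_insert)
      qed
      then have y: "?y \<in> ann (F \<union> S)"
        using u_ann[of F "Suc i"] F by (auto intro: ann_diff)
      have "\<iota> ?y \<in> ann (F \<union> S)"
        unfolding ann_def using \<iota>(3)[of _ ?y] annD[OF y] \<iota>0 by (auto simp: neg_equal_0_iff_equal)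
      moreover have "x e (\<iota> ?y) = ?y"
        using \<iota>(2)[of ?y] v0[of F] F \<iota>0 by simp
      ultimately show ?thesis by blast
    qed
    then obtain v' where v': "\<And>F. \<lbrakk>F \<subseteq> P; Suc (card F) + i = j\<rbrakk> \<Longrightarrow>
        v' F \<in> ann (F \<union> S) \<and> x e (v' F) = u (Suc i) F - codiff v F"
      by metis
    have "x e (u i F - codiff v' F) = 0" if F: "F \<subseteq> P" "card F + i = j" for F
    proof -
      have "codiff (\<lambda>F. x e (v' F)) F = codiff (\<lambda>F. u (Suc i) F - codiff v F) F"
        using F fin[OF F(1)]
        by (intro codiff_cong, subst v'[THEN conjunct2]) (auto simp: card_Suc_Diff1 simp del: card_Diff_insert)
      then have "- x e (codiff v' F) = codiff (u (Suc i)) F"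
        using fin[OF F(1)] by (simp add: codiff_op codiff_diff codiff_codiff)
      then have "x e (codiff v' F) = - codiff (u (Suc i)) F"
        by (metis add.inverse_inverse)
      then show ?thesis
        using u_op[OF F] by (simp add: op_diff)
    qed
    then show ?case
      using v' by (intro exI[of _ v']) auto
  qed
  show ?thesis
  proof (cases j)
    case 0
    \<comment> \<open>For j = 0 there are no sets of size j - 1, so any w will do; the zero family
      is taken.\<close>
    have "x e (z {}) = 0"
      using u_op[of "{}" 0] 0 finP by (simp add: u_def div_power_zero codiff_def)
    then show ?thesis
      using 0 fin by (intro exI[of _ "\<lambda>_. 0"]) (auto simp: codiff_def)
  next
    case (Suc j')
    then obtain v where v: "\<And>F. \<lbrakk>F \<subseteq> P; Suc (card F) + 1 = j\<rbrakk> \<Longrightarrow> v F \<in> ann (F \<union> S)"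
      and v0: "\<And>F. \<lbrakk>F \<subseteq> P; card F + 1 = j\<rbrakk> \<Longrightarrow> x e (u 1 F - codiff v F) = 0"
      using descent[of 1 j'] by auto
    let ?w = "\<lambda>F. codiff v F - u 1 F"
    have "?w F \<in> ann (insert e (F \<union> S))" if F: "F \<subseteq> P" "Suc (card F) = j" for F
    proof -
      have "codiff v F \<in> ann (F \<union> S)"
      proof (rule codiff_ann)
        fix f assume "f \<in> F"
        then show "v (F - {f}) \<in> ann (F - {f} \<union> S)"
          using F fin[OF F(1)] by (intro v) (auto simp: card_Suc_Diff1 simp del: card_Diff_insert)
      qed
      then have "?w F \<in> ann (F \<union> S)"
        using u_ann[of F 1] F by (auto intro: ann_diff)
      then show ?thesis
        using v0[of F] F by (auto simp: ann_def op_diff)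
    qed
    moreover have "x e (z N) = codiff ?w N" if N: "N \<subseteq> P" "card N = j" for N
      using u_op[of N 0] N fin[OF N(1)] finP
      by (simp add: codiff_diff codiff_codiff u_def div_power_zero)
    ultimately show ?thesis by (intro exI[of _ ?w]) simp
  qed
qed

text \<open>The induction removes one edge of \<open>P\<close> at a time. Deletion keeps
  \<open>S\<close> and \<open>k\<close>; contraction moves the edge into \<open>S\<close> and lowers
  \<open>k\<close> by one, so that \<open>k + card S\<close> and the bound by \<open>g\<close> are
  preserved.\<close>

theorem codiff_image_saturated:
  assumes "P \<subseteq> E" "S \<subseteq> E" "P \<inter> S = {}" "enat (k + card S) < g" "0 < m"
    and "\<And>F. \<lbrakk>F \<subseteq> P; Suc (card F) = k\<rbrakk> \<Longrightarrow> b F \<in> ann (F \<union> S)"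
    and "\<And>F. \<lbrakk>F \<subseteq> P; card F = k\<rbrakk> \<Longrightarrow> c F \<in> ann (F \<union> S)"
    and "\<And>N. \<lbrakk>N \<subseteq> P; card N = k\<rbrakk> \<Longrightarrow> frag_cmul m (c N) = codiff b N"
  shows "\<exists>a. (\<forall>F. F \<subseteq> P \<longrightarrow> Suc (card F) = k \<longrightarrow> a F \<in> ann (F \<union> S)) \<and>
    (\<forall>N. N \<subseteq> P \<longrightarrow> card N = k \<longrightarrow> c N = codiff a N)"
proof -
  have "finite P" using assms(1) finite_E finite_subset by blast
  then show ?thesis
    using assms
  proof (induction P arbitrary: S k b c rule: finite_induct)
    case empty
    have "c {} = 0" if "k = 0"
      using empty.prems(5) empty.prems(8)[of "{}"] that by (simp add: codiff_def)
    then show ?case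
      by (intro exI[of _ "\<lambda>_. 0"]) (auto simp: codiff_def)
  next
    case (insert e P)
    note b = insert.prems(6) and c = insert.prems(7) and mc = insert.prems(8)
    have fin: "finite F" if "F \<subseteq> P" for F using that insert(1) finite_subset by blast
    have PE: "P \<subseteq> E" and SE: "S \<subseteq> E" and e: "e \<in> E - (P \<union> S)" and m: "m \<noteq> 0"
      using insert by auto
    have finS: "finite S" using SE finite_E finite_subset by blast
    \<comment> \<open>The part on sets avoiding \<open>e\<close> is solved first, by the induction
      hypothesis for the deletion.\<close>
    obtain a' where a': "\<And>F. \<lbrakk>F \<subseteq> P; Suc (card F) = k\<rbrakk> \<Longrightarrow> a' F \<in> ann (F \<union> S)"
      and ca': "\<And>N. \<lbrakk>N \<subseteq> P; card N = k\<rbrakk> \<Longrightarrow> c N = codiff a' N"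
      using insert.IH[of S k b c] insert.prems b c mc by (auto simp: subset_insertI2)
    show ?case
    proof (cases k)
      case 0
      have "c {} = 0"
        using mc[of "{}"] m 0 by (simp add: codiff_def)
      moreover have "N = {}" if "N \<subseteq> insert e P" "card N = 0" for N
        using that insert(1) finite_subset[of N "insert e P"] by auto
      ultimately show ?thesis
        using 0 by (intro exI[of _ "\<lambda>_. 0"]) (auto simp: codiff_def)
    next
      case (Suc j)
      have card_e: "card (insert e F) = Suc (card F)" if "F \<subseteq> P" for F
        using that fin insert(2) by (subst card_insert_disjoint) auto
      \<comment> \<open>On the deletion both b and \<open>m a'\<close> have codifferential
        \<open>m c\<close>, so z is a cycle. What remains on the contraction is c', the part of c
        not yet accounted for by \<open>x e (a' F)\<close>, and it satisfies
        \<open>m c' = x e z + codiff b'\<close>.\<close>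
      define z where "z F = b F - frag_cmul m (a' F)" for F
      define b' where "b' F = b (insert e F)" for F
      define c' where "c' F = c (insert e F) - x e (a' F)" for F
      have z: "z F \<in> ann (F \<union> S)" if "F \<subseteq> P" "card F = j" for F
        unfolding z_def using that Suc by (intro ann_diff ann_cmul a' b) auto
      have dz: "codiff z N = 0" if "N \<subseteq> P" "card N = Suc j" for N
        unfolding z_def codiff_diff codiff_cmul using that Suc mc[of N, symmetric] ca'[of N, symmetric] by auto
      have b': "b' F \<in> ann (F \<union> insert e S)" if "F \<subseteq> P" "Suc (card F) = j" for F
        unfolding b'_def using that b[of "insert e F"] card_e Suc by auto
      have c': "c' F \<in> ann (F \<union> insert e S)" if "F \<subseteq> P" "card F = j" for F
        unfolding c'_def using that c[of "insert e F"] card_e Suc ann_op[OF a', of F e]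
        by (intro ann_diff) auto
      have mc': "frag_cmul m (c' N) = x e (z N) + codiff b' N" if "N \<subseteq> P" "card N = j" for N
      proof -
        have "frag_cmul m (c (insert e N)) = codiff b (insert e N)"
          using that card_e Suc by (intro mc) auto
        also have "\<dots> = x e (b N) + codiff b' N"
          using that fin insert(2) by (subst codiff_insert) (auto simp: b'_def[abs_def])
        finally show ?thesis
          by (simp add: c'_def z_def op_diff op_cmul frag_cmul_diff algebra_simps)
      qed
      \<comment> \<open>A solution on the cone is glued from a1 on sets avoiding \<open>e\<close>
        and a2 on sets containing \<open>e\<close>.\<close>
      have combine: ?thesis if
        a: "\<And>F. \<lbrakk>F \<subseteq> P; Suc (card F) = k\<rbrakk> \<Longrightarrow> a1 F \<in> ann (F \<union> S)"
          "\<And>F. \<lbrakk>F \<subseteq> P; Suc (card F) = j\<rbrakk> \<Longrightarrow> a2 F \<in> ann (F \<union> insert e S)"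
          "\<And>N. \<lbrakk>N \<subseteq> P; card N = k\<rbrakk> \<Longrightarrow> c N = codiff a1 N"
          "\<And>N. \<lbrakk>N \<subseteq> P; card N = j\<rbrakk> \<Longrightarrow> c (insert e N) = x e (a1 N) + codiff a2 N" for a1 a2
      proof -
        define a where "a F = (if e \<in> F then a2 (F - {e}) else a1 F)" for F
        have a_P: "a F = a1 F" "a (insert e F) = a2 F" if "F \<subseteq> P" for F
          using that insert(2) by (auto simp: a_def intro!: arg_cong[where f = a2])
        have split: "F \<subseteq> P \<or> (\<exists>G. G \<subseteq> P \<and> F = insert e G)" if "F \<subseteq> insert e P" for F
        proof (cases "e \<in> F")
          case True
          then have "F = insert e (F - {e})" "F - {e} \<subseteq> P" using that by auto
          then show ?thesis by blast
        qed (use that in auto)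
        have "a F \<in> ann (F \<union> S)" if F: "F \<subseteq> insert e P" "Suc (card F) = k" for F
          using split[OF F(1)]
        proof (elim disjE exE conjE)
          fix G assume "G \<subseteq> P" "F = insert e G"
          then show ?thesis using a(2)[of G] F card_e Suc by (auto simp: a_P)
        qed (use a(1) F a_P in auto)
        moreover have "c N = codiff a N" if N: "N \<subseteq> insert e P" "card N = k" for N
          using split[OF N(1)]
        proof (elim disjE exE conjE)
          assume "N \<subseteq> P"
          moreover from this have "codiff a N = codiff a1 N"
            by (intro codiff_cong a_P) auto
          ultimately show ?thesis using a(3) N by auto
        next
          fix G assume G: "G \<subseteq> P" "N = insert e G"
          have "codiff (\<lambda>F. a (insert e F)) G = codiff a2 G"
            using G by (intro codiff_cong a_P) auto
          then show ?thesis
            using G N fin insert(2) card_e a(4)[of G] Suc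
            by (subst G(2), subst codiff_insert) (auto simp: a_P)
        qed
        ultimately show ?thesis by (intro exI[of _ a]) simp
      qed
      have "P \<union> S \<subseteq> E" using PE SE by simp
      from independent_or_spanned[OF this e]
      consider (indep) \<iota> where "contraction x e (P \<union> S) \<iota>"
        | (spanned) q where "\<And>a. x e a = (\<Sum>t\<in>P \<union> S. frag_cmul (q t) (x t a))"
        by blast
      then show ?thesis
      proof cases
        case indep
        then have \<iota>: "\<And>a b. \<iota> (a + b) = \<iota> a + \<iota> b" "\<And>a. x e (\<iota> a) = a - \<iota> (x e a)"
          "\<And>f a. f \<in> P \<union> S \<Longrightarrow> \<iota> (x f a) = - x f (\<iota> a)"
          by (auto simp: contraction_def)
        have \<iota>0: "\<iota> 0 = 0" using \<iota>(1)[of 0 0] by simp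
        have \<iota>sum: "\<iota> (sum h A) = (\<Sum>i\<in>A. \<iota> (h i))" for h and A :: "'e set"
          by (induction A rule: infinite_finite_induct) (simp_all add: \<iota>0 \<iota>(1))
        have op_\<iota>: "x f (\<iota> a) = - \<iota> (x f a)" if "f \<in> P \<union> S" for f a
          using \<iota>(3)[OF that, of a] by simp
        \<comment> \<open>The codifferential of \<open>m c' = x e z + codiff b'\<close> vanishes
          because z is a cycle, and m can be cancelled.\<close>
        have dc': "codiff c' N = 0" if N: "N \<subseteq> P" "card N = k" for N
        proof -
          have "frag_cmul m (codiff c' N) = codiff (\<lambda>F. x e (z F) + codiff b' F) N"
            unfolding codiff_cmul[symmetric]
            using N Suc fin by (intro codiff_cong mc') auto
          also have "\<dots> = 0"
            using N fin dz[of N] Suc by (simp add: codiff_add codiff_codiff codiff_op)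
          finally show ?thesis using m by simp
        qed
        show ?thesis
        \<comment> \<open>Since c' is killed by \<open>x e\<close>, it equals
          \<open>x e (\<iota> c')\<close> and can be absorbed into a'. As c' is a cycle and
          \<open>\<iota>\<close> anticommutes with the remaining operators, this does not change the
          codifferential on the deletion, and a2 can be zero.\<close>
        proof (rule combine[of "\<lambda>F. a' F + \<iota> (c' F)" "\<lambda>_. 0"])
          fix F assume F: "F \<subseteq> P" "Suc (card F) = k"
          have "c' F \<in> ann (F \<union> insert e S)" using F Suc by (intro c') auto
          then have "\<iota> (c' F) \<in> ann (F \<union> S)"
            using F by (auto simp: ann_def op_\<iota> \<iota>0 subset_iff)
          then show "a' F + \<iota> (c' F) \<in> ann (F \<union> S)"
            using F a' by (intro ann_add) auto
        next
          fix N assume N: "N \<subseteq> P" "card N = k"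
          have "codiff (\<lambda>F. \<iota> (c' F)) N = - \<iota> (codiff c' N)"
            unfolding codiff_def \<iota>sum sum_negf[symmetric] using N op_\<iota>
            by (intro sum.cong) auto
          then show "c N = codiff (\<lambda>F. a' F + \<iota> (c' F)) N"
            using N ca' dc' by (simp add: codiff_add \<iota>0)
        next
          fix N assume N: "N \<subseteq> P" "card N = j"
          have "x e (\<iota> (c' N)) = c' N"
            using \<iota>(2)[of "c' N"] annD[OF c'[OF N], of e] \<iota>0 by simp
          then show "c (insert e N) = x e (a' N + \<iota> (c' N)) + codiff (\<lambda>_. 0) N"
            by (simp add: op_add c'_def codiff_def)
        qed auto
      next
        case spanned
        \<comment> \<open>On the annihilator of \<open>S\<close> the summands from \<open>S\<close>
          vanish, leaving a combination of edges of \<open>P\<close> alone.\<close>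
        have xe: "x e a = (\<Sum>t\<in>P. frag_cmul (q t) (x t a))" if "a \<in> ann S" for a
          unfolding spanned using that insert(1) finS
          by (intro sum.mono_neutral_right) (auto simp: ann_def)
        have jS: "enat (Suc (j + card S)) < g" using insert.prems(4) Suc by simp
        have "\<exists>w. (\<forall>F. F \<subseteq> P \<longrightarrow> Suc (card F) = j \<longrightarrow> w F \<in> ann (insert e (F \<union> S))) \<and>
            (\<forall>N. N \<subseteq> P \<longrightarrow> card N = j \<longrightarrow> x e (z N) = codiff w N)"
          using PE SE e jS z dz xe by (rule op_null_homotopic)
        then obtain w where w: "\<And>F. \<lbrakk>F \<subseteq> P; Suc (card F) = j\<rbrakk> \<Longrightarrow> w F \<in> ann (insert e (F \<union> S))"
          and xz: "\<And>N. \<lbrakk>N \<subseteq> P; card N = j\<rbrakk> \<Longrightarrow> x e (z N) = codiff w N"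
          by blast
        \<comment> \<open>Now \<open>m c' = codiff (w + b')\<close> on the contraction, so the
          induction hypothesis applies with \<open>e\<close> moved into \<open>S\<close>.\<close>
        have "\<exists>a2. (\<forall>F. F \<subseteq> P \<longrightarrow> Suc (card F) = j \<longrightarrow> a2 F \<in> ann (F \<union> insert e S)) \<and>
            (\<forall>N. N \<subseteq> P \<longrightarrow> card N = j \<longrightarrow> c' N = codiff a2 N)"
        proof (rule insert.IH)
          show "enat (j + card (insert e S)) < g"
            using jS finS e by (simp add: card_insert_if)
          show "w F + b' F \<in> ann (F \<union> insert e S)" if "F \<subseteq> P" "Suc (card F) = j" for F
            using that w b' by (intro ann_add) auto
          show "frag_cmul m (c' N) = codiff (\<lambda>F. w F + b' F) N" if "N \<subseteq> P" "card N = j" for N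
            using that mc' xz by (simp add: codiff_add)
        qed (use insert.prems(1-5) insert(2) e c' in auto)
        then obtain a2 where "\<And>F. \<lbrakk>F \<subseteq> P; Suc (card F) = j\<rbrakk> \<Longrightarrow> a2 F \<in> ann (F \<union> insert e S)"
          "\<And>N. \<lbrakk>N \<subseteq> P; card N = j\<rbrakk> \<Longrightarrow> c' N = codiff a2 N" by blast
        then show ?thesis
          using a' ca' by (intro combine[of a' a2]) (auto simp: c'_def algebra_simps)
      qed
    qed
  qed
qed

end

section \<open>Products of the operators and common annihilators\<close>

locale ordered_anticommuting_operators = anticommuting_operators E x g
  for E :: "'e::linorder set" and x :: "'e \<Rightarrow> ('b \<Rightarrow>\<^sub>0 int) \<Rightarrow> ('b \<Rightarrow>\<^sub>0 int)" and g
begin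

text \<open>Multiplication by the product of the \<open>x\<^sub>e\<close> with e in I. The linear
  order of the edges serves only to fix its sign.\<close>

definition product :: "'e set \<Rightarrow> ('b \<Rightarrow>\<^sub>0 int) \<Rightarrow> ('b \<Rightarrow>\<^sub>0 int)" where
  "product I = foldr x (sorted_list_of_set I)"

lemma product_empty [simp]: "product {} a = a"
  by (simp add: product_def)

lemma product_diff: "product I (a - b) = product I a - product I b"
proof -
  have "foldr x xs (a - b) = foldr x xs a - foldr x xs b" for xs
    by (induction xs) (simp_all add: op_diff)
  then show ?thesis by (simp add: product_def)
qed

lemma product_cmul: "product I (frag_cmul k a) = frag_cmul k (product I a)"
proof -
  have "foldr x xs (frag_cmul k a) = frag_cmul k (foldr x xs a)" for xs
    by (induction xs) (simp_all add: op_cmul)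
  then show ?thesis by (simp add: product_def)
qed

lemma product_zero [simp]: "product I 0 = 0"
  using product_cmul[of I 0 0] by simp

lemma product_sum: "product I (sum f A) = (\<Sum>i\<in>A. product I (f i))"
proof (induction A rule: infinite_finite_induct)
  case (insert i A)
  have "f i + sum f A = f i - (0 - sum f A)" by simp
  then have "product I (f i + sum f A) = product I (f i) + product I (sum f A)"
    by (simp only: product_diff product_zero) simp
  then show ?case using insert by simp
qed simp_all

text \<open>Moving \<open>x r\<close> to the front past the factors of smaller index costs one sign
  each.\<close>

lemma product_insert:
  assumes "finite I" "r \<notin> I"
  shows "\<exists>\<sigma>. \<sigma> \<in> {1, -1} \<and> (\<forall>a. product (insert r I) a = frag_cmul \<sigma> (x r (product I a)))"
proof -
  have "\<exists>\<sigma>. \<sigma> \<in> {1, -1} \<and> (\<forall>a. foldr x (insort r xs) a = frag_cmul \<sigma> (x r (foldr x xs a)))" for xs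
  proof (induction xs)
    case Nil
    show ?case by (rule exI[of _ 1]) simp
  next
    case (Cons y ys)
    show ?case
    proof (cases "r \<le> y")
      case True
      then show ?thesis by (intro exI[of _ 1]) simp
    next
      case False
      from Cons obtain \<sigma> where "\<sigma> \<in> {1, -1}"
        "\<And>a. foldr x (insort r ys) a = frag_cmul \<sigma> (x r (foldr x ys a))" by auto
      with False show ?thesis
        by (intro exI[of _ "- \<sigma>"]) (auto simp: op_cmul op_minus op_anticommute[of y r])
    qed
  qed
  then show ?thesis using assms by (simp add: product_def sorted_list_of_set_insert)
qed

lemma product_ann:
  assumes "finite I"
  shows "product I a \<in> ann I"
  unfolding ann_def
proof (intro CollectI ballI)
  fix f assume "f \<in> I"
  then have I: "I = insert f (I - {f})" by auto
  obtain \<sigma> where "product I a = frag_cmul \<sigma> (x f (product (I - {f}) a))"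
    using product_insert[of "I - {f}" f] assms I by auto
  then show "x f (product I a) = 0" by (simp add: op_cmul)
qed

text \<open>An element killed by \<open>x r\<close> is \<open>x r (\<iota> a)\<close> for a
  contraction \<open>\<iota>\<close> along r, and \<open>\<iota> a\<close> is still killed by the
  other operators, so the factors can be split off one at a time. Together with
  \<open>product_ann\<close> this identifies the image of \<open>product I\<close> for small
  I.\<close>

lemma ann_imp_product:
  assumes "I \<subseteq> E" "enat (card I) < g" "a \<in> ann I"
  shows "\<exists>b. a = product I b"
proof -
  have "finite I" using assms(1) finite_E finite_subset by blast
  then show ?thesis
    using assms
  proof (induction I arbitrary: a rule: finite_induct)
    case empty
    then show ?case by (intro exI[of _ a]) simp
  next
    case (insert r I)
    have less: "enat (Suc (card I)) < g" using insert by simp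
    then obtain \<iota> where "contraction x r I \<iota>"
      using independent[of I r] insert by auto
    then have \<iota>: "\<And>a b. \<iota> (a + b) = \<iota> a + \<iota> b" "\<And>a. x r (\<iota> a) = a - \<iota> (x r a)"
      "\<And>f a. f \<in> I \<Longrightarrow> \<iota> (x f a) = - x f (\<iota> a)"
      by (auto simp: contraction_def)
    have \<iota>0: "\<iota> 0 = 0" using \<iota>(1)[of 0 0] by simp
    have a0: "x f a = 0" if "f \<in> insert r I" for f using annD[OF insert.prems(3) that] .
    have "x f (\<iota> a) = 0" if "f \<in> I" for f
      using \<iota>(3)[OF that, of a] a0[of f] that \<iota>0 by simp
    then have "\<iota> a \<in> ann I" by (simp add: ann_def)
    moreover have "enat (card I) < g" using less by (metis enat_ord_simps(2) lessI less_trans)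
    ultimately obtain b where b: "\<iota> a = product I b" using insert by auto
    obtain \<sigma> where \<sigma>: "\<sigma> \<in> {1, -1}" "\<And>a. product (insert r I) a = frag_cmul \<sigma> (x r (product I a))"
      using product_insert[OF insert(1,2)] by auto
    have "a = x r (product I b)" using \<iota>(2)[of a] a0[of r] \<iota>0 b by simp
    also have "\<dots> = product (insert r I) (frag_cmul \<sigma> b)"
      using \<sigma> by (auto simp: product_cmul op_cmul)
    finally show ?case by blast
  qed
qed

end

text \<open>The part of the hypercube up to level k has no nontrivial sign cocycles: the signs along
  a path from the empty set to I multiply to a value that does not depend on the path, because
  neighbouring paths differ by a square.\<close>

lemma sign_cocycle_is_coboundary:
  fixes s :: "'e::linorder set \<Rightarrow> 'e \<Rightarrow> int"
  assumes "finite E"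
    and unit: "\<And>I r. \<lbrakk>I \<subseteq> E; r \<in> E - I; card I < k\<rbrakk> \<Longrightarrow> s I r \<in> {1, -1}"
    and square: "\<And>I r t. \<lbrakk>I \<subseteq> E; r \<in> E - I; t \<in> E - I; r \<noteq> t; card I + 2 \<le> k\<rbrakk> \<Longrightarrow>
      s (insert r I) t * s I r = s (insert t I) r * s I t"
  shows "\<exists>\<tau>. (\<forall>I. I \<subseteq> E \<longrightarrow> card I \<le> k \<longrightarrow> \<tau> I \<in> {1, -1 :: int}) \<and>
    (\<forall>I r. I \<subseteq> E \<longrightarrow> r \<in> E - I \<longrightarrow> card I < k \<longrightarrow> s I r = \<tau> I * \<tau> (insert r I))"
proof -
  \<comment> \<open>The signs are multiplied along the path that adds the elements of I in
    increasing order.\<close>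
  define \<tau> where "\<tau> I = (\<Prod>r\<in>I. s {t \<in> I. t < r} r)" for I
  have fin: "finite I" if "I \<subseteq> E" for I using that assms(1) finite_subset by blast
  have prod_unit: "prod f J \<in> {1, -1}" if "finite J" "\<forall>r\<in>J. f r \<in> {1, -1}"
    for J and f :: "'e \<Rightarrow> int"
    using that by (induction J rule: finite_induct) auto
  have \<tau>_unit: "\<tau> I \<in> {1, -1}" if I: "I \<subseteq> E" "card I \<le> k" for I
  proof -
    have "s {t \<in> I. t < r} r \<in> {1, -1}" if "r \<in> I" for r
    proof (rule unit)
      have "{t \<in> I. t < r} \<subset> I" using that by auto
      from psubset_card_mono[OF fin[OF I(1)] this] show "card {t \<in> I. t < r} < k"
        using I(2) by simp
    qed (use that I in auto)
    with fin[OF I(1)] have "(\<Prod>r\<in>I. s {t \<in> I. t < r} r) \<in> {1, -1}" by (intro prod_unit) auto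
    then show ?thesis by (simp add: \<tau>_def)
  qed
  have \<tau>_Max: "\<tau> J = \<tau> (J - {M}) * s (J - {M}) M"
    if J: "J \<subseteq> E" "M \<in> J" "\<And>t. t \<in> J \<Longrightarrow> t \<le> M" for J M
  proof -
    have "\<tau> J = s {t \<in> J. t < M} M * (\<Prod>r\<in>J - {M}. s {t \<in> J. t < r} r)"
      unfolding \<tau>_def using J fin by (subst prod.remove[of J M]) auto
    also have "{t \<in> J. t < M} = J - {M}" using J by (auto simp: order.strict_iff_order)
    also have "(\<Prod>r\<in>J - {M}. s {t \<in> J. t < r} r) = \<tau> (J - {M})"
      unfolding \<tau>_def
    proof (rule prod.cong, simp)
      fix r assume "r \<in> J - {M}"
      then have "{t \<in> J. t < r} = {t \<in> J - {M}. t < r}" using J by (auto dest: leD)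
      then show "s {t \<in> J. t < r} r = s {t \<in> J - {M}. t < r} r" by simp
    qed
    finally show ?thesis by (simp add: mult.commute)
  qed
  have step: "\<tau> J = \<tau> (J - {r}) * s (J - {r}) r" if "J \<subseteq> E" "card J \<le> k" "r \<in> J" for J r
    using that
  proof (induction "card J" arbitrary: J r rule: less_induct)
    case less
    define M where "M = Max J"
    have M: "M \<in> J" "\<And>t. t \<in> J \<Longrightarrow> t \<le> M"
      using less.prems fin[of J] by (auto simp: M_def intro!: Max_in)
    show ?case
    proof (cases "r = M")
      case True
      then show ?thesis using \<tau>_Max M less.prems by blast
    next
      case False
      \<comment> \<open>If r is not the last element M, the path to J ending with r is compared with
        the one ending with M across the square above I; the induction hypothesis applies to
        \<open>J - {M}\<close>.\<close>
      define I where "I = J - {r} - {M}"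
      have "card J = Suc (card (J - {r}))" "card (J - {r}) = Suc (card I)" "card J = Suc (card (J - {M}))"
        using less.prems M False fin[of J] unfolding I_def by (simp_all add: card_Suc_Diff1 del: card_Diff_insert)
      then have card: "card J = card I + 2" "card (J - {M}) < card J" by simp_all
      have sets: "J - {M} - {r} = I" "insert r I = J - {M}" "insert M I = J - {r}"
        using False M less.prems by (auto simp: I_def)
      have "\<tau> (J - {M}) = \<tau> I * s I r"
        using less.hyps[of "J - {M}" r] card less.prems False sets by auto
      moreover have "\<tau> (J - {r}) = \<tau> I * s I M"
        using \<tau>_Max[of "J - {r}" M] M less.prems False by (auto simp: I_def)
      moreover have "s (insert r I) M * s I r = s (insert M I) r * s I M"
      proof (rule square)
        show "I \<subseteq> E" "r \<in> E - I" "M \<in> E - I" "r \<noteq> M"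
          using less.prems M(1) False by (auto simp: I_def)
        show "card I + 2 \<le> k" using card(1) less.prems(2) by simp
      qed
      moreover have "\<tau> J = \<tau> (J - {M}) * s (J - {M}) M"
        using less.prems(1) M by (rule \<tau>_Max)
      ultimately show ?thesis
        unfolding sets by (simp only: mult.assoc) (simp only: mult.commute)
    qed
  qed
  have "s I r = \<tau> I * \<tau> (insert r I)" if "I \<subseteq> E" "r \<in> E - I" "card I < k" for I r
  proof -
    have "\<tau> (insert r I) = \<tau> I * s I r"
      using step[of "insert r I" r] that fin by auto
    then show ?thesis using \<tau>_unit[of I] that by auto
  qed
  with \<tau>_unit show ?thesis by (intro exI[of _ \<tau>]) blast
qed

section \<open>Operators on exterior algebras from graphs\<close>

lemma frag_additive_eqI:
  assumes "\<And>a b. f (a - b) = f a - f b" "\<And>a b. h (a - b) = h a - h b"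
    and "\<And>S. S \<in> Poly_Mapping.keys a \<Longrightarrow> f (frag_of S) = h (frag_of S)"
  shows "f a = (h a :: 'c \<Rightarrow>\<^sub>0 int)"
proof (rule frag_induction[of a "Poly_Mapping.keys a"])
  show "f 0 = h 0" using assms(1)[of 0 0] assms(2)[of 0 0] by simp
qed (use assms in auto)

section \<open>Wedge and interior products on monomials\<close>

abbreviation wedge_var :: "nat \<Rightarrow> ext \<Rightarrow> ext" where
  "wedge_var a \<equiv> ext_wedge (ext_var a)"

definition sign_below :: "nat \<Rightarrow> nat set \<Rightarrow> int" where
  "sign_below a S = (-1) ^ card {t \<in> S. t < a}"

text \<open>Interior product with the dual of the variable \<open>X\<^sub>a\<close>.\<close>

definition contract_var :: "nat \<Rightarrow> ext \<Rightarrow> ext" where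
  "contract_var a =
     frag_extend (\<lambda>S. if a \<in> S then frag_cmul (sign_below a S) (frag_of (S - {a})) else 0)"

lemma ext_wedge_diff_right: "ext_wedge a (b - c) = ext_wedge a b - ext_wedge a c"
  by (rule frag_additive_eqI[of "\<lambda>a. ext_wedge a (b - c)" "\<lambda>a. ext_wedge a b - ext_wedge a c"])
    (simp_all add: ext_wedge_def frag_extend_diff)

lemma wedge_var_add: "wedge_var a (b + c) = wedge_var a b + wedge_var a c"
  by (simp add: ext_wedge_def ext_var_def frag_extend_add)

lemma wedge_var_diff: "wedge_var a (b - c) = wedge_var a b - wedge_var a c"
  by (simp add: ext_wedge_def ext_var_def frag_extend_diff)

lemma wedge_var_cmul: "wedge_var a (frag_cmul k b) = frag_cmul k (wedge_var a b)"
  by (simp add: ext_wedge_def ext_var_def frag_extend_cmul)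

lemma wedge_var_zero [simp]: "wedge_var a 0 = 0"
  by (simp add: ext_wedge_def ext_var_def)

lemma wedge_var_monom:
  "wedge_var a (frag_of S) = (if a \<in> S then 0 else frag_cmul (sign_below a S) (frag_of (insert a S)))"
proof -
  have "{(s, t). s \<in> {a} \<and> t \<in> S \<and> t < s} = Pair a ` {t \<in> S. t < a}" by auto
  then have "card {(s, t). s \<in> {a} \<and> t \<in> S \<and> t < s} = card {t \<in> S. t < a}"
    by (simp add: card_image inj_on_def)
  then show ?thesis
    by (simp add: ext_wedge_def ext_var_def ext_wedge_monom_def sign_below_def)
qed

lemma sign_below_insert:
  "b \<notin> S \<Longrightarrow> sign_below a (insert b S) = (if b < a then - sign_below a S else sign_below a S)"
proof -
  assume "b \<notin> S"
  moreover have "finite {t \<in> S. t < a}" by (rule finite_subset[of _ "{..<a}"]) auto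
  moreover have "{t \<in> insert b S. t < a} = (if b < a then insert b {t \<in> S. t < a} else {t \<in> S. t < a})"
    by auto
  ultimately show ?thesis by (simp add: sign_below_def)
qed

lemma sign_below_square [simp]: "sign_below a S * sign_below a S = 1"
  by (simp add: sign_below_def flip: power_add)

lemma sign_below_remove:
  "b \<in> S \<Longrightarrow> sign_below a (S - {b}) = (if b < a then - sign_below a S else sign_below a S)"
  using sign_below_insert[of b "S - {b}" a] by (auto simp: insert_absorb)

lemma wedge_var_anticommute: "wedge_var a (wedge_var b \<omega>) = - wedge_var b (wedge_var a \<omega>)"
proof (rule frag_additive_eqI[of "\<lambda>\<omega>. wedge_var a (wedge_var b \<omega>)" "\<lambda>\<omega>. - wedge_var b (wedge_var a \<omega>)"])
  fix S
  show "wedge_var a (wedge_var b (frag_of S)) = - wedge_var b (wedge_var a (frag_of S))"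
    by (auto simp: wedge_var_monom wedge_var_cmul sign_below_insert insert_commute mult.commute)
qed (simp_all add: wedge_var_diff)

lemma contract_var_add: "contract_var a (b + c) = contract_var a b + contract_var a c"
  and contract_var_diff: "contract_var a (b - c) = contract_var a b - contract_var a c"
  and contract_var_cmul: "contract_var a (frag_cmul k b) = frag_cmul k (contract_var a b)"
  by (simp_all add: contract_var_def frag_extend_add frag_extend_diff frag_extend_cmul)

lemma contract_var_zero [simp]: "contract_var a 0 = 0"
  by (simp add: contract_var_def)

lemma contract_var_monom:
  "contract_var a (frag_of S) = (if a \<in> S then frag_cmul (sign_below a S) (frag_of (S - {a})) else 0)"
  by (simp add: contract_var_def)

text \<open>The interior product is an antiderivation; on monomials this is a comparison of the
  signs of inserting b and removing a in either order.\<close>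

lemma contract_var_wedge_var:
  "contract_var a (wedge_var b \<omega>) = (if a = b then \<omega> else 0) - wedge_var b (contract_var a \<omega>)"
proof (rule frag_additive_eqI[of "\<lambda>\<omega>. contract_var a (wedge_var b \<omega>)"
      "\<lambda>\<omega>. (if a = b then \<omega> else 0) - wedge_var b (contract_var a \<omega>)"])
  fix S
  show "contract_var a (wedge_var b (frag_of S))
    = (if a = b then frag_of S else 0) - wedge_var b (contract_var a (frag_of S))"
  proof (cases "a = b")
    case True
    then show ?thesis
      by (auto simp: wedge_var_monom wedge_var_cmul contract_var_monom contract_var_cmul
          sign_below_insert sign_below_remove insert_absorb)
  next
    case False
    then have "insert b S - {a} = insert b (S - {a})" by auto
    then show ?thesis using False
      by (auto simp: wedge_var_monom wedge_var_cmul contract_var_monom contract_var_cmul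
          sign_below_insert sign_below_remove mult.commute)
  qed
qed (simp_all add: wedge_var_diff contract_var_diff)

lemma contract_var_eq_0: "(\<And>S. S \<in> Poly_Mapping.keys \<omega> \<Longrightarrow> a \<notin> S) \<Longrightarrow> contract_var a \<omega> = 0"
  unfolding contract_var_def by (rule frag_extend_eq_0) auto

text \<open>The sum is interior product with the functional that is 1 on the variables in W and 0 on
  the others.\<close>

lemma sum_contract_var_wedge_var:
  assumes "finite W"
  shows "(\<Sum>a\<in>W. contract_var a (wedge_var b \<omega>))
    = (if b \<in> W then \<omega> else 0) - wedge_var b (\<Sum>a\<in>W. contract_var a \<omega>)"
proof -
  have "wedge_var b (\<Sum>a\<in>W. contract_var a \<omega>) = (\<Sum>a\<in>W. wedge_var b (contract_var a \<omega>))"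
    by (induction W rule: infinite_finite_induct) (simp_all add: wedge_var_add)
  then show ?thesis
    using assms by (simp add: contract_var_wedge_var sum_subtractf)
qed

text \<open>The projection to the degree s part of the exterior algebra on V. Preimages obtained
  from \<open>ann_imp_product\<close> may involve any variables and degrees, and are cut down to the
  right bidegree by it.\<close>

definition graded_part :: "nat set \<Rightarrow> nat \<Rightarrow> ext \<Rightarrow> ext" where
  "graded_part V s = frag_extend (\<lambda>S. if S \<subseteq> V \<and> card S = s then frag_of S else 0)"

lemma graded_part_diff: "graded_part V s (a - b) = graded_part V s a - graded_part V s b"
  and graded_part_cmul: "graded_part V s (frag_cmul k a) = frag_cmul k (graded_part V s a)"
  by (simp_all add: graded_part_def frag_extend_diff frag_extend_cmul)

lemma keys_graded_part: "Poly_Mapping.keys (graded_part V s \<omega>) \<subseteq> {S. S \<subseteq> V \<and> card S = s}"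
  unfolding graded_part_def
  by (rule order_trans[OF keys_frag_extend]) (auto split: if_splits)

lemma graded_part_id:
  assumes "Poly_Mapping.keys \<omega> \<subseteq> {S. S \<subseteq> V \<and> card S = s}"
  shows "graded_part V s \<omega> = \<omega>"
proof -
  have "graded_part V s \<omega> = frag_extend frag_of \<omega>"
    unfolding graded_part_def using assms by (intro frag_extend_eq) auto
  then show ?thesis by (simp flip: frag_expansion)
qed

lemma graded_part_wedge_var:
  assumes "finite V" "a \<in> V"
  shows "graded_part V (Suc s) (wedge_var a \<omega>) = wedge_var a (graded_part V s \<omega>)"
proof (rule frag_additive_eqI[of "\<lambda>\<omega>. graded_part V (Suc s) (wedge_var a \<omega>)"
      "\<lambda>\<omega>. wedge_var a (graded_part V s \<omega>)"])
  fix S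
  show "graded_part V (Suc s) (wedge_var a (frag_of S)) = wedge_var a (graded_part V s (frag_of S))"
  proof (cases "S \<subseteq> V")
    case True
    then have "finite S" using assms finite_subset by blast
    then show ?thesis
      using assms True
      by (auto simp: wedge_var_monom graded_part_cmul) (auto simp: graded_part_def wedge_var_monom)
  qed (auto simp: wedge_var_monom graded_part_cmul, auto simp: graded_part_def wedge_var_monom)
qed (simp_all add: wedge_var_diff graded_part_diff)

lemma monom_eq_foldr:
  assumes "finite S"
  shows "frag_of S = foldr wedge_var (sorted_list_of_set S) (frag_of {})"
proof -
  have "frag_of (set xs) = foldr wedge_var xs (frag_of {})" if "sorted xs" "distinct xs" for xs
    using that
  proof (induction xs)
    case (Cons a xs)
    then have "{t \<in> set xs. t < a} = {}" by auto
    then have "sign_below a (set xs) = 1" by (simp add: sign_below_def del: Collect_empty_eq)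
    with Cons show ?case by (simp add: wedge_var_monom flip: Cons.IH)
  qed simp
  from this[of "sorted_list_of_set S"] show ?thesis using assms by simp
qed

lemma ext_map_diff: "ext_map \<phi> (a - b) = ext_map \<phi> a - ext_map \<phi> b"
  by (simp add: ext_map_def frag_extend_diff)

lemma keys_foldr_wedge_var:
  "Poly_Mapping.keys (foldr (\<lambda>a. wedge_var (\<phi> a)) xs (frag_of {})) \<subseteq> {S. S \<subseteq> \<phi> ` set xs \<and> card S = length xs}"
proof (induction xs)
  case (Cons a xs)
  let ?\<omega> = "foldr (\<lambda>a. wedge_var (\<phi> a)) xs (frag_of {})"
  have "Poly_Mapping.keys (wedge_var (\<phi> a) ?\<omega>) \<subseteq> (\<Union>S\<in>Poly_Mapping.keys ?\<omega>. Poly_Mapping.keys (wedge_var (\<phi> a) (frag_of S)))"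
    unfolding ext_wedge_def ext_var_def frag_extend_of by (rule keys_frag_extend)
  also have "\<dots> \<subseteq> {S. S \<subseteq> \<phi> ` set (a # xs) \<and> card S = length (a # xs)}"
  proof clarsimp
    fix S T assume "T \<in> Poly_Mapping.keys ?\<omega>" and S: "S \<in> Poly_Mapping.keys (wedge_var (\<phi> a) (frag_of T))"
    then have T: "T \<subseteq> \<phi> ` set xs" "card T = length xs" using Cons by auto
    then have "finite T" using finite_subset by blast
    with S T show "S \<subseteq> insert (\<phi> a) (\<phi> ` set xs) \<and> card S = Suc (length xs)"
      by (auto simp: wedge_var_monom split: if_splits)
  qed
  finally show ?case by simp
qed simp

text \<open>Monomials in which two variables become equal vanish, so all surviving ones keep their
  degree; this is why an arbitrary condition P on the degree is inherited.\<close>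

lemma keys_ext_map:
  assumes "Poly_Mapping.keys \<omega> \<subseteq> {S. S \<subseteq> V \<and> P (card S)}" "finite V"
  shows "Poly_Mapping.keys (ext_map \<phi> \<omega>) \<subseteq> {S. S \<subseteq> \<phi> ` V \<and> P (card S)}"
  unfolding ext_map_def
proof (rule order_trans[OF keys_frag_extend], rule UN_least)
  fix S assume "S \<in> Poly_Mapping.keys \<omega>"
  then have S: "S \<subseteq> V" "P (card S)" "finite S" using assms finite_subset by blast+
  have "Poly_Mapping.keys (foldr (\<lambda>a. wedge_var (\<phi> a)) (sorted_list_of_set S) (frag_of {}))
      \<subseteq> {T. T \<subseteq> \<phi> ` S \<and> card T = card S}"
    using keys_foldr_wedge_var[of \<phi> "sorted_list_of_set S"] S(3) by simp
  also have "\<dots> \<subseteq> {S. S \<subseteq> \<phi> ` V \<and> P (card S)}"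
    using image_mono[OF S(1), of \<phi>] S(2) by (auto simp del: image_mono)
  finally show "Poly_Mapping.keys (foldr (\<lambda>a. wedge_var (\<phi> a)) (sorted_list_of_set S) (frag_of {}))
      \<subseteq> {S. S \<subseteq> \<phi> ` V \<and> P (card S)}" .
qed

section \<open>Edge operators of a graph: independence and spanning\<close>

definition edge_relation :: "('e \<Rightarrow> 'v) \<Rightarrow> ('e \<Rightarrow> 'v) \<Rightarrow> 'e set \<Rightarrow> ('v \<times> 'v) set" where
  "edge_relation u v F = (\<Union>e\<in>F. {(u e, v e), (v e, u e)})"

lemma edge_relation_insert:
  "edge_relation u v (insert e F) = edge_relation u v F \<union> {(u e, v e), (v e, u e)}"
  by (auto simp: edge_relation_def)

lemma edge_relation_mono: "F \<subseteq> F' \<Longrightarrow> edge_relation u v F \<subseteq> edge_relation u v F'"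
  by (auto simp: edge_relation_def)

definition edge_op :: "('e \<Rightarrow> nat) \<Rightarrow> ('e \<Rightarrow> nat) \<Rightarrow> 'e \<Rightarrow> ext \<Rightarrow> ext" where
  "edge_op u v e \<omega> = wedge_var (u e) \<omega> - wedge_var (v e) \<omega>"

lemma wedge_var_edge_op: "wedge_var a (edge_op u v e \<omega>) = - edge_op u v e (wedge_var a \<omega>)"
  by (simp add: edge_op_def wedge_var_diff wedge_var_anticommute[of a])

text \<open>The functional is the indicator of the component of \<open>u e\<close> in the graph with
  edges F. It is 1 on \<open>x\<^sub>e\<close>, as \<open>v e\<close> lies elsewhere, and 0 on
  \<open>x\<^sub>f\<close> for f in F, whose ends lie on the same side.\<close>

lemma contraction_edge_op:
  assumes "finite F" and sep: "(u e, v e) \<notin> (edge_relation u v F)\<^sup>*"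
  shows "\<exists>\<iota>. contraction (edge_op u v) e F \<iota>"
proof -
  \<comment> \<open>Only \<open>u e\<close> and ends of edges in F can be reached from
    \<open>u e\<close>; the intersection merely makes finiteness evident.\<close>
  define W where "W = {a. (u e, a) \<in> (edge_relation u v F)\<^sup>*} \<inter> insert (u e) (u ` F \<union> v ` F)"
  have W: "finite W" using assms by (simp add: W_def)
  have e: "u e \<in> W" "v e \<notin> W" using sep by (auto simp: W_def)
  have F: "u f \<in> W \<longleftrightarrow> v f \<in> W" if "f \<in> F" for f
  proof -
    have "(u f, v f) \<in> edge_relation u v F" "(v f, u f) \<in> edge_relation u v F"
      using that by (auto simp: edge_relation_def)
    then show ?thesis using that by (auto simp: W_def intro: rtrancl_into_rtrancl)
  qed
  define \<iota> where "\<iota> a = (\<Sum>w\<in>W. contract_var w a)" for a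
  have wedge: "\<iota> (wedge_var b \<omega>) = (if b \<in> W then \<omega> else 0) - wedge_var b (\<iota> \<omega>)" for b \<omega>
    unfolding \<iota>_def by (rule sum_contract_var_wedge_var[OF W])
  have diff: "\<iota> (a - b) = \<iota> a - \<iota> b" for a b
    by (simp add: \<iota>_def contract_var_diff sum_subtractf)
  have "contraction (edge_op u v) e F \<iota>"
    unfolding contraction_def
  proof (intro conjI allI ballI)
    show "\<iota> (a + b) = \<iota> a + \<iota> b" for a b
      by (simp add: \<iota>_def contract_var_add sum.distrib)
    show "edge_op u v e (\<iota> a) = a - \<iota> (edge_op u v e a)" for a
      using e by (simp add: edge_op_def diff wedge)
    show "\<iota> (edge_op u v f a) = - edge_op u v f (\<iota> a)" if "f \<in> F" for f a
      using F[OF that] by (simp add: edge_op_def diff wedge)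
  qed
  then show ?thesis by blast
qed

text \<open>The difference of the two variables telescopes along a path from a to b, each edge
  contributing plus or minus its own difference. An edge may be traversed repeatedly, so its
  coefficients are added up.\<close>

lemma edge_op_spanned:
  assumes "finite F" and "(a, b) \<in> (edge_relation u v F)\<^sup>*"
  shows "\<exists>c. \<forall>\<omega>. wedge_var a \<omega> - wedge_var b \<omega> = (\<Sum>t\<in>F. frag_cmul (c t) (edge_op u v t \<omega>))"
  using assms(2)
proof (induction rule: rtrancl_induct)
  case base
  show ?case by (rule exI[of _ "\<lambda>_. 0"]) simp
next
  case (step y z)
  from step(3) obtain c where c:
    "\<And>\<omega>. wedge_var a \<omega> - wedge_var y \<omega> = (\<Sum>t\<in>F. frag_cmul (c t) (edge_op u v t \<omega>))" by blast
  obtain e k where e: "e \<in> F" "\<And>\<omega>. wedge_var y \<omega> - wedge_var z \<omega> = frag_cmul k (edge_op u v e \<omega>)"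
  proof -
    obtain e where "e \<in> F" "y = u e \<and> z = v e \<or> y = v e \<and> z = u e"
      using step(2) by (auto simp: edge_relation_def)
    then show ?thesis using that[of e 1] that[of e "-1"] by (auto simp: edge_op_def)
  qed
  have "wedge_var a \<omega> - wedge_var z \<omega> = (\<Sum>t\<in>F. frag_cmul ((c(e := c e + k)) t) (edge_op u v t \<omega>))" for \<omega>
  proof -
    have "wedge_var a \<omega> - wedge_var z \<omega>
        = (wedge_var a \<omega> - wedge_var y \<omega>) + (wedge_var y \<omega> - wedge_var z \<omega>)" by simp
    also have "\<dots> = (\<Sum>t\<in>F. frag_cmul (c t) (edge_op u v t \<omega>)) + frag_cmul k (edge_op u v e \<omega>)"
      by (simp only: c e(2))
    also have "\<dots> = (\<Sum>t\<in>F. frag_cmul (c t) (edge_op u v t \<omega>))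
        + (\<Sum>t\<in>F. if t = e then frag_cmul k (edge_op u v t \<omega>) else 0)"
      using assms(1) e(1) by simp
    also have "\<dots> = (\<Sum>t\<in>F. frag_cmul ((c(e := c e + k)) t) (edge_op u v t \<omega>))"
      unfolding sum.distrib[symmetric] by (rule sum.cong) (auto simp: frag_cmul_distrib)
    finally show ?thesis .
  qed
  then show ?case by blast
qed

lemma edge_ops_anticommuting:
  assumes "finite E"
    and sep: "\<And>F e. \<lbrakk>F \<subseteq> E; e \<in> E - F; enat (Suc (card F)) < g\<rbrakk> \<Longrightarrow>
      (u e, v e) \<notin> (edge_relation u v F)\<^sup>*"
  shows "ordered_anticommuting_operators E (edge_op u v) g"
proof
  fix F e assume F: "F \<subseteq> E" "e \<in> E - F"
  then have fin: "finite F" using assms(1) finite_subset by blast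
  show "\<exists>\<iota>. contraction (edge_op u v) e F \<iota>" if "enat (Suc (card F)) < g"
    using contraction_edge_op[OF fin] sep[OF F that] by blast
  show "(\<exists>\<iota>. contraction (edge_op u v) e F \<iota>) \<or>
    (\<exists>c. \<forall>a. edge_op u v e a = (\<Sum>t\<in>F. frag_cmul (c t) (edge_op u v t a)))"
  proof (cases "(u e, v e) \<in> (edge_relation u v F)\<^sup>*")
    case True
    from edge_op_spanned[OF fin True] show ?thesis unfolding edge_op_def by blast
  next
    case False
    then show ?thesis using contraction_edge_op[OF fin] by blast
  qed
next
  show "edge_op u v e (a + b) = edge_op u v e a + edge_op u v e b" for e a b
    by (simp add: edge_op_def wedge_var_add)
  show "edge_op u v e (edge_op u v f a) = - edge_op u v f (edge_op u v e a)" for e f a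
    by (simp add: edge_op_def[of u v e] wedge_var_edge_op) (simp add: edge_op_def wedge_var_diff)
qed (fact assms(1))

locale graph_operators = ordered_anticommuting_operators E "edge_op u v" g
  for E :: "'e::linorder set" and u v :: "'e \<Rightarrow> nat" and g
begin

lemma wedge_var_product:
  "product I (wedge_var a \<omega>) = frag_cmul ((-1) ^ length (sorted_list_of_set I)) (wedge_var a (product I \<omega>))"
proof -
  have "foldr (edge_op u v) xs (wedge_var a \<omega>)
      = frag_cmul ((-1) ^ length xs) (wedge_var a (foldr (edge_op u v) xs \<omega>))" for xs
    by (induction xs) (simp_all add: op_cmul wedge_var_edge_op frag_cmul_uminus)
  then show ?thesis by (simp add: product_def)
qed

text \<open>The product is killed by the difference of the ends of each edge in I, so the ends of
  such an edge are interchangeable as factors, and so are the vertices along a path.\<close>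

lemma wedge_var_product_connected:
  assumes "finite I" "(a, b) \<in> (edge_relation u v I)\<^sup>*"
  shows "wedge_var a (product I \<omega>) = wedge_var b (product I \<omega>)"
  using assms(2)
proof (induction rule: rtrancl_induct)
  case (step y z)
  then obtain e where "e \<in> I" "{y, z} = {u e, v e}" by (auto simp: edge_relation_def)
  moreover from this have "edge_op u v e (product I \<omega>) = 0"
    using product_ann[OF assms(1)] annD by blast
  ultimately have "wedge_var y (product I \<omega>) = wedge_var z (product I \<omega>)"
    by (auto simp: edge_op_def doubleton_eq_iff)
  with step show ?case by simp
qed simp

text \<open>Renaming variables within components of the graph with edges I becomes invisible after
  multiplication by \<open>product I\<close>. This is how the merge maps disappear from the embedded
  complex.\<close>

lemma product_ext_map:
  assumes "finite I" "finite V" "\<And>a. a \<in> V \<Longrightarrow> (a, \<phi> a) \<in> (edge_relation u v I)\<^sup>*"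
    and "Poly_Mapping.keys \<omega> \<subseteq> Pow V"
  shows "product I (ext_map \<phi> \<omega>) = product I \<omega>"
proof (rule frag_additive_eqI[of "\<lambda>\<omega>. product I (ext_map \<phi> \<omega>)"])
  fix S assume "S \<in> Poly_Mapping.keys \<omega>"
  then have "S \<subseteq> V" using assms(4) by auto
  then have S: "S \<subseteq> V" "finite S" using finite_subset[OF _ assms(2)] by auto
  have *: "product I (foldr (\<lambda>a. wedge_var (\<phi> a)) xs (frag_of {})) = product I (foldr wedge_var xs (frag_of {}))"
    if "set xs \<subseteq> V" for xs
    using that
  proof (induction xs)
    case (Cons a xs)
    then show ?case
      using wedge_var_product_connected[OF assms(1,3)] by (simp add: wedge_var_product)
  qed simp
  have "product I (ext_map \<phi> (frag_of S))
      = product I (foldr (\<lambda>a. wedge_var (\<phi> a)) (sorted_list_of_set S) (frag_of {}))"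
    by (simp add: ext_map_def)
  also have "\<dots> = product I (foldr wedge_var (sorted_list_of_set S) (frag_of {}))"
    using S by (intro *) simp
  also have "\<dots> = product I (frag_of S)"
    by (simp only: monom_eq_foldr[OF S(2), symmetric])
  finally show "product I (ext_map \<phi> (frag_of S)) = product I (frag_of S)" .
qed (simp_all add: ext_map_diff product_diff)

lemma graded_part_edge_op:
  assumes "finite V" "u e \<in> V" "v e \<in> V"
  shows "graded_part V (Suc s) (edge_op u v e \<omega>) = edge_op u v e (graded_part V s \<omega>)"
  using assms by (simp add: edge_op_def graded_part_diff graded_part_wedge_var)

lemma graded_part_product:
  assumes "finite V" "finite I" "u ` I \<union> v ` I \<subseteq> V"
  shows "graded_part V (s + card I) (product I \<omega>) = product I (graded_part V s \<omega>)"
proof -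
  have "graded_part V (s + length xs) (foldr (edge_op u v) xs \<omega>)
      = foldr (edge_op u v) xs (graded_part V s \<omega>)" if "set xs \<subseteq> I" for xs
    using that
  proof (induction xs)
    case (Cons a xs)
    then show ?case
      using assms by (simp add: graded_part_edge_op image_subset_iff)
  qed simp
  from this[of "sorted_list_of_set I"] show ?thesis using assms by (simp add: product_def)
qed

end

section \<open>Kauffman states below the girth\<close>

text \<open>A simple path is extended edge by edge; if the new vertex already lies on it, the path
  is cut off there instead.\<close>

lemma connected_imp_path:
  assumes "(a, b) \<in> (edge_relation u v F)\<^sup>*"
    and "a \<in> mg_verts G" "\<And>e. e \<in> F \<Longrightarrow> mg_ends G e = {u e, v e} \<and> mg_ends G e \<subseteq> mg_verts G"
  shows "\<exists>vs es. vs \<noteq> [] \<and> hd vs = a \<and> last vs = b \<and> distinct vs \<and> distinct es \<and>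
    set vs \<subseteq> mg_verts G \<and> set es \<subseteq> F \<and> length vs = Suc (length es) \<and>
    (\<forall>i < length es. mg_ends G (es ! i) = {vs ! i, vs ! Suc i})"
  using assms(1)
proof (induction rule: rtrancl_induct)
  case base
  then show ?case
    using assms(2) by (intro exI[of _ "[a]"] exI[of _ "[]"]) simp
next
  case (step y z)
  then obtain vs es where p: "vs \<noteq> []" "hd vs = a" "last vs = y" "distinct vs" "distinct es"
    "set vs \<subseteq> mg_verts G" "set es \<subseteq> F" "length vs = Suc (length es)"
    "\<And>i. i < length es \<Longrightarrow> mg_ends G (es ! i) = {vs ! i, vs ! Suc i}"
    by blast
  obtain e where e: "e \<in> F" "mg_ends G e = {y, z}"
    using step(2) assms(3) by (auto simp: edge_relation_def)
  show ?case
  proof (cases "z \<in> set vs")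
    case True
    then obtain i where i: "i < length vs" "vs ! i = z" by (auto simp: in_set_conv_nth)
    have "last (take (Suc i) vs) = z"
      using i by (simp add: take_Suc_conv_app_nth)
    then show ?thesis
      using p i
      by (intro exI[of _ "take (Suc i) vs"] exI[of _ "take i es"])
        (auto dest: in_set_takeD simp: hd_take)
  next
    case False
    \<comment> \<open>An edge already used has both its ends on the path, but z is not on
      it.\<close>
    have "e \<notin> set es"
    proof
      assume "e \<in> set es"
      then obtain i where "i < length es" "es ! i = e" by (auto simp: in_set_conv_nth)
      then have "z \<in> set vs" using p(8) p(9)[of i] e by (auto simp: doubleton_eq_iff)
      then show False using False by simp
    qed
    moreover have "vs ! length es = y" using p by (simp add: last_conv_nth)
    moreover have "z \<in> mg_verts G" using assms(3)[OF e(1)] e by auto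
    ultimately show ?thesis
      using p e False
      by (intro exI[of _ "vs @ [z]"] exI[of _ "es @ [e]"]) (auto simp: nth_append less_Suc_eq)
  qed
qed

text \<open>The edge r closes a simple path in F to a cycle. If r is a loop, the path is a single
  vertex and the cycle has length 1.\<close>

lemma girth_le_if_connected:
  assumes "(u r, v r) \<in> (edge_relation u v F)\<^sup>*" "finite F" "r \<notin> F"
    and "insert r F \<subseteq> mg_edges G"
    and ends: "\<And>e. e \<in> insert r F \<Longrightarrow> mg_ends G e = {u e, v e} \<and> mg_ends G e \<subseteq> mg_verts G"
  shows "mg_girth G \<le> enat (Suc (card F))"
proof -
  obtain vs es where p: "vs \<noteq> []" "hd vs = u r" "last vs = v r" "distinct vs" "distinct es"
    "set vs \<subseteq> mg_verts G" "set es \<subseteq> F" "length vs = Suc (length es)"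
    "\<And>i. i < length es \<Longrightarrow> mg_ends G (es ! i) = {vs ! i, vs ! Suc i}"
    using connected_imp_path[OF assms(1), of G] ends by blast
  have "mg_ends G ((es @ [r]) ! i) = {vs ! i, vs ! (Suc i mod length (es @ [r]))}"
    if "i < length (es @ [r])" for i
  proof (cases "i = length es")
    case True
    then show ?thesis
      using p ends[of r] by (auto simp: last_conv_nth hd_conv_nth)
  qed (use that p in \<open>auto simp: nth_append\<close>)
  then have "mg_cycle G vs (es @ [r])"
    unfolding mg_cycle_def using p assms(3,4) by auto
  then have "mg_girth G \<le> enat (length (es @ [r]))"
    unfolding mg_girth_def by (intro Inf_lower) blast
  also have "length es \<le> card F"
    using p assms(2) by (metis distinct_card card_mono)
  then have "enat (length (es @ [r])) \<le> enat (Suc (card F))" by simp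
  finally show ?thesis .
qed

section \<open>Circles of a state and the effect of one new B-resolution\<close>

lemma card_even_if_involution:
  assumes "finite A" "\<And>a. a \<in> A \<Longrightarrow> f a \<in> A" "\<And>a. a \<in> A \<Longrightarrow> f (f a) = a" "\<And>a. a \<in> A \<Longrightarrow> f a \<noteq> a"
  shows "even (card A)"
  using assms
proof (induction "card A" arbitrary: A rule: less_induct)
  case less
  show ?case
  proof (cases "A = {}")
    case False
    then obtain a where a: "a \<in> A" by auto
    have "{a, f a} \<subseteq> A" "card {a, f a} = 2"
      using a less.prems(2,4)[of a] by (auto simp: card_insert_if)
    then have card: "card A = card (A - {a, f a}) + 2"
      using less.prems(1) card_mono[of A "{a, f a}"] by (simp add: card_Diff_subset)
    have "f b \<in> A - {a, f a}" if "b \<in> A - {a, f a}" for b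
      using that a less.prems(2-4) by (metis DiffD1 DiffD2 DiffI insert_iff singletonD)
    then have "even (card (A - {a, f a}))"
      using card less.prems by (intro less.hyps) auto
    then show ?thesis using card by simp
  qed simp
qed

definition same_component :: "link_diagram \<Rightarrow> nat set \<Rightarrow> (nat \<times> nat) set" where
  "same_component D I = (state_rel D I)\<^sup>*"

lemma smooth_at:
  "k < 4 \<Longrightarrow> smooth I (4 * r + k) = 4 * r + (if r \<in> I then 3 - k else if even k then k + 1 else k - 1)"
  by (simp add: smooth_def Let_def)

lemma smooth_values:
  "r \<notin> I \<Longrightarrow> smooth I (4 * r) = 4 * r + 1" "r \<notin> I \<Longrightarrow> smooth I (4 * r + 1) = 4 * r"
  "r \<notin> I \<Longrightarrow> smooth I (4 * r + 2) = 4 * r + 3" "r \<notin> I \<Longrightarrow> smooth I (4 * r + 3) = 4 * r + 2"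
  "r \<in> I \<Longrightarrow> smooth I (4 * r) = 4 * r + 3" "r \<in> I \<Longrightarrow> smooth I (4 * r + 3) = 4 * r"
  "r \<in> I \<Longrightarrow> smooth I (4 * r + 1) = 4 * r + 2" "r \<in> I \<Longrightarrow> smooth I (4 * r + 2) = 4 * r + 1"
  using smooth_at[of 0 I r] smooth_at[of 1 I r] smooth_at[of 2 I r] smooth_at[of 3 I r] by simp_all

lemmas smooth_simps = smooth_values smooth_values[simplified]

lemma Suc_div_4: "Suc (4 * r) div 4 = r" "Suc (Suc (4 * r)) div 4 = r" "(4 * r + 3) div 4 = r"
  by simp_all

lemma halfedge_cases:
  obtains r where "p = 4 * r" | r where "p = 4 * r + 1" | r where "p = 4 * r + 2"
    | r where "p = 4 * r + (3 :: nat)"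
proof -
  have "p mod 4 < 4" "p = 4 * (p div 4) + p mod 4" by simp_all
  then show ?thesis using that[of "p div 4"] by linarith
qed

lemma smooth_div: "smooth I p div 4 = p div 4"
  and smooth_smooth: "smooth I (smooth I p) = p"
  and smooth_neq: "smooth I p \<noteq> p"
proof -
  have "smooth I p div 4 = p div 4 \<and> smooth I (smooth I p) = p \<and> smooth I p \<noteq> p"
    by (cases p rule: halfedge_cases; cases "p div 4 \<in> I") (simp_all add: smooth_simps Suc_div_4)
  then show "smooth I p div 4 = p div 4" "smooth I (smooth I p) = p" "smooth I p \<noteq> p"
    by simp_all
qed

lemma smooth_halfedges: "p \<in> halfedges D \<Longrightarrow> smooth I p \<in> halfedges D"
proof -
  assume "p \<in> halfedges D"
  then have "p div 4 < ncross D" by (simp add: halfedges_def less_mult_imp_div_less mult.commute)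
  then have "smooth I p div 4 < ncross D" by (simp add: smooth_div)
  then show ?thesis by (simp add: halfedges_def div_less_iff_less_mult mult.commute)
qed

lemma smooth_insert: "p div 4 \<noteq> r \<Longrightarrow> smooth (insert r I) p = smooth I p"
  by (simp add: smooth_def Let_def)

context
  fixes D :: link_diagram
  assumes D: "is_link_diagram D"
begin

lemma opp_halfedges: "p \<in> halfedges D \<Longrightarrow> opp D p \<in> halfedges D"
  and opp_opp: "p \<in> halfedges D \<Longrightarrow> opp D (opp D p) = p"
  and opp_neq: "p \<in> halfedges D \<Longrightarrow> opp D p \<noteq> p"
  using D unfolding is_link_diagram_def by metis+

lemma state_rel_sym: "sym (state_rel D I)"
  by (auto simp: sym_def state_rel_def opp_opp smooth_smooth)

lemma same_component_sym: "(p, q) \<in> same_component D I \<Longrightarrow> (q, p) \<in> same_component D I"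
  unfolding same_component_def using sym_rtrancl[OF state_rel_sym] by (rule symD)

lemma same_component_trans:
  "\<lbrakk>(p, q) \<in> same_component D I; (q, r) \<in> same_component D I\<rbrakk> \<Longrightarrow> (p, r) \<in> same_component D I"
  unfolding same_component_def by (rule rtrancl_trans)

lemma same_component_refl [simp]: "(p, p) \<in> same_component D I"
  by (simp add: same_component_def)

lemma same_component_smooth: "p \<in> halfedges D \<Longrightarrow> (p, smooth I p) \<in> same_component D I"
  unfolding same_component_def by (auto simp: state_rel_def smooth_halfedges)

text \<open>
  Otherwise the involution \<open>opp D\<close> would show that the part still connected to \<open>p\<close> has an even number
  of half-edges, and the smoothing, which pairs all of them except \<open>p\<close>, that this number is odd.
\<close>

lemma connected_without_strand:
  assumes p: "p \<in> halfedges D" and r: "p div 4 = r"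
    and sep: "\<And>q. \<lbrakk>q div 4 = r; q \<noteq> p; q \<noteq> smooth I p\<rbrakk> \<Longrightarrow> (p, q) \<notin> same_component D I"
  shows "(p, smooth I p) \<in> {(p, q). (p, q) \<in> state_rel D I \<and> (q = opp D p \<or> p div 4 \<noteq> r)}\<^sup>*"
proof (rule ccontr)
  let ?R = "{(p, q). (p, q) \<in> state_rel D I \<and> (q = opp D p \<or> p div 4 \<noteq> r)}"
  assume not: "(p, smooth I p) \<notin> ?R\<^sup>*"
  define K where "K = {q. (p, q) \<in> ?R\<^sup>*}"
  have step: "b \<in> K" if "a \<in> K" "(a, b) \<in> ?R" for a b
    using that unfolding K_def by (auto intro: rtrancl_into_rtrancl)
  have pK: "p \<in> K" by (simp add: K_def)
  have KH: "K \<subseteq> halfedges D"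
  proof
    fix q assume "q \<in> K"
    then have "(p, q) \<in> ?R\<^sup>*" by (simp add: K_def)
    then show "q \<in> halfedges D" by (cases rule: rtranclE) (use p in \<open>auto simp: state_rel_def\<close>)
  qed
  then have fin: "finite K" by (rule finite_subset) (simp add: halfedges_def)
  have KS: "K \<subseteq> {q. (p, q) \<in> same_component D I}"
  proof -
    have "?R\<^sup>* \<subseteq> same_component D I" unfolding same_component_def by (rule rtrancl_mono) auto
    then show ?thesis unfolding K_def by auto
  qed
  \<comment> \<open>At the crossing r, the half-edges of the other strand are excluded by
    \<open>sep\<close>, and the other end of the strand of p by the assumption for
    contradiction.\<close>
  have K_r: "q = p" if "q \<in> K" "q div 4 = r" for q
    using that sep[of q] KS not by (auto simp: K_def)
  have "even (card K)"
  proof (rule card_even_if_involution[where f = "opp D"])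
    fix q assume q: "q \<in> K"
    then have H: "q \<in> halfedges D" using KH by auto
    show "opp D q \<in> K" by (rule step[OF q]) (simp add: state_rel_def H opp_halfedges)
    show "opp D (opp D q) = q" "opp D q \<noteq> q" using H by (simp_all add: opp_opp opp_neq)
  qed (rule fin)
  moreover have "even (card (K - {p}))"
  proof (rule card_even_if_involution[where f = "smooth I"])
    fix q assume q: "q \<in> K - {p}"
    then have H: "q \<in> halfedges D" using KH by auto
    have r': "q div 4 \<noteq> r" using q K_r by auto
    have "smooth I q \<in> K" by (rule step[of q]) (use q in \<open>simp_all add: state_rel_def H r' smooth_halfedges\<close>)
    moreover have "smooth I q \<noteq> p" using r r' by (metis smooth_div)
    ultimately show "smooth I q \<in> K - {p}" by simp
  qed (use fin smooth_smooth smooth_neq in auto)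
  ultimately show False
    using pK fin by (metis card_Suc_Diff1 even_Suc)
qed

text \<open>Two different circles passing through r are merged, and nothing else changes. Each
  circle without its strand at r is still an arc between the ends of that strand, so after the
  B-resolution all four half-edges at r lie on one circle.\<close>

lemma same_component_insert:
  assumes r: "r < ncross D" "r \<notin> I" and sep: "(4 * r, 4 * r + 2) \<notin> same_component D I"
  shows "same_component D (insert r I)
    = (state_rel D I \<union> {(4 * r, 4 * r + 2), (4 * r + 2, 4 * r)})\<^sup>*"
    (is "?J = ?R\<^sup>*")
proof (intro equalityI)
  have H: "4 * r + k \<in> halfedges D" if "k < 4" for k
    using r that by (auto simp: halfedges_def)
  have H': "4 * r \<in> halfedges D" "4 * r + 1 \<in> halfedges D" "4 * r + 2 \<in> halfedges D" "4 * r + 3 \<in> halfedges D"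
    using H[of 0] H[of 1] H[of 2] H[of 3] by auto
  have at_r: "p = 4 * r \<or> p = 4 * r + 1 \<or> p = 4 * r + 2 \<or> p = 4 * r + 3" if "p div 4 = r" for p
    using that by linarith
  have symR: "sym ?R" using state_rel_sym[of I] by (auto simp: sym_def)
  have IR: "same_component D I \<subseteq> ?R\<^sup>*" unfolding same_component_def by (rule rtrancl_mono) auto
  have s01: "(4 * r, 4 * r + 1) \<in> same_component D I" "(4 * r + 2, 4 * r + 3) \<in> same_component D I"
    using same_component_smooth[OF H'(1), of I] same_component_smooth[OF H'(3), of I] r(2)
    by (simp_all add: smooth_simps)
  have e02: "(4 * r, 4 * r + 2) \<in> ?R\<^sup>*" by auto
  have e03: "(4 * r, 4 * r + 3) \<in> ?R\<^sup>*"
    using e02 s01(2) IR by (blast intro: rtrancl_trans)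
  have e12: "(4 * r + 1, 4 * r + 2) \<in> ?R\<^sup>*"
    using same_component_sym[OF s01(1)] e02 IR by (blast intro: rtrancl_trans)
  have e: "(4 * r + 3, 4 * r) \<in> ?R\<^sup>*" "(4 * r + 2, 4 * r + 1) \<in> ?R\<^sup>*"
    using e03 e12 sym_rtrancl[OF symR] by (auto dest: symD)
  show "?J \<subseteq> ?R\<^sup>*"
    unfolding same_component_def
  proof (rule rtrancl_subset_rtrancl, rule subrelI)
    fix p q assume pq: "(p, q) \<in> state_rel D (insert r I)"
    show "(p, q) \<in> ?R\<^sup>*"
    proof (cases "q \<noteq> opp D p \<and> p div 4 = r")
      case True
      then have q: "q = smooth (insert r I) p" using pq by (simp add: state_rel_def)
      have "p = 4 * r \<or> p = 4 * r + 1 \<or> p = 4 * r + 2 \<or> p = 4 * r + 3" using True at_r by blast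
      then show ?thesis
        unfolding q by (elim disjE) (use e03 e12 e in \<open>simp_all add: smooth_simps\<close>)
    next
      case False
      then have "(p, q) \<in> state_rel D I" using pq by (auto simp: state_rel_def smooth_insert)
      then show ?thesis by auto
    qed
  qed
  \<comment> \<open>Every step other than along a strand at r is available in both states.\<close>
  have restr: "{(p, q). (p, q) \<in> state_rel D I \<and> (q = opp D p \<or> p div 4 \<noteq> r)}\<^sup>* \<subseteq> ?J"
    unfolding same_component_def by (rule rtrancl_mono) (auto simp: state_rel_def smooth_insert)
  have "(4 * r, smooth I (4 * r)) \<in> ?J"
  proof (rule subsetD[OF restr], rule connected_without_strand)
    fix q assume q: "q div 4 = r" "q \<noteq> 4 * r" "q \<noteq> smooth I (4 * r)"
    then have "q = 4 * r + 2 \<or> q = 4 * r + 3" using at_r[of q] r by (auto simp: smooth_simps)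
    then show "(4 * r, q) \<notin> same_component D I"
      using sep same_component_sym[OF s01(2)] by (auto dest: same_component_trans)
  qed (use H' in auto)
  then have j01: "(4 * r, 4 * r + 1) \<in> ?J" using r by (simp add: smooth_simps)
  have "(4 * r + 2, smooth I (4 * r + 2)) \<in> ?J"
  proof (rule subsetD[OF restr], rule connected_without_strand)
    fix q assume q: "q div 4 = r" "q \<noteq> 4 * r + 2" "q \<noteq> smooth I (4 * r + 2)"
    then have "q = 4 * r \<or> q = 4 * r + 1" using at_r[of q] r by (auto simp: smooth_simps)
    then show "(4 * r + 2, q) \<notin> same_component D I"
      using sep same_component_sym[OF s01(1)] by (auto dest: same_component_trans same_component_sym)
  qed (use H' in auto)
  then have j23: "(4 * r + 2, 4 * r + 3) \<in> ?J" using r by (simp add: smooth_simps)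
  have j12: "(4 * r + 1, 4 * r + 2) \<in> ?J"
    using same_component_smooth[OF H'(2), of "insert r I"] by (simp add: smooth_simps)
  have j02: "(4 * r, 4 * r + 2) \<in> ?J" using j01 j12 by (rule same_component_trans)
  show "?R\<^sup>* \<subseteq> ?J"
    unfolding same_component_def
  proof (rule rtrancl_subset_rtrancl, rule subrelI)
    fix p q assume pq: "(p, q) \<in> ?R"
    then have "p = 4 * r \<and> q = 4 * r + 2 \<or> p = 4 * r + 2 \<and> q = 4 * r \<or> (p, q) \<in> state_rel D I"
      by (simp only: Un_iff insert_iff empty_iff prod.inject) blast
    then consider "(p, q) \<in> state_rel D I" "q \<noteq> opp D p \<and> p div 4 = r"
      | "(p, q) \<in> state_rel D I" "q = opp D p \<or> p div 4 \<noteq> r"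
      | "p = 4 * r" "q = 4 * r + 2" | "p = 4 * r + 2" "q = 4 * r" by blast
    then have "(p, q) \<in> ?J"
    proof cases
      case 1
      then have q: "q = smooth I p" by (simp add: state_rel_def)
      have "p = 4 * r \<or> p = 4 * r + 1 \<or> p = 4 * r + 2 \<or> p = 4 * r + 3" using 1 at_r by blast
      then show ?thesis
        unfolding q
        by (elim disjE)
          (use r j01 j23 same_component_sym[OF j01] same_component_sym[OF j23] in
            \<open>simp_all add: smooth_simps\<close>)
    next
      case 2
      then show ?thesis using restr by auto
    next
      case 4
      then show ?thesis using same_component_sym[OF j02] by simp
    qed (use j02 in simp)
    then show "(p, q) \<in> (state_rel D (insert r I))\<^sup>*" by (simp add: same_component_def)
  qed
qed

end

section \<open>Components of states as vertices of the state graph\<close>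

lemma mem_components_iff:
  "p \<in> components D I \<longleftrightarrow> p < 4 * ncross D + ncirc D \<and> component D I p = p" 
proof -
  have le: "component D I q \<le> q" for q
    unfolding component_def by (rule Least_le) simp
  have idem: "component D I (component D I q) = component D I q" for q
  proof -
    have *: "(q, component D I q) \<in> (state_rel D I)\<^sup>*"
      unfolding component_def by (rule LeastI[of _ q]) simp
    have "component D I q \<le> component D I (component D I q)"
      unfolding component_def[of D I q]
      by (rule Least_le) (use * in \<open>auto simp: component_def intro: rtrancl_trans LeastI\<close>)
    then show ?thesis using le[of "component D I q"] by simp
  qed
  show ?thesis
  proof
    assume "p \<in> components D I"
    then obtain q where "q < 4 * ncross D + ncirc D" "p = component D I q"
      by (auto simp: components_def)
    then show "p < 4 * ncross D + ncirc D \<and> component D I p = p"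
      using le[of q] idem[of q] by simp
  next
    assume "p < 4 * ncross D + ncirc D \<and> component D I p = p"
    then show "p \<in> components D I"
      unfolding components_def by (metis imageI lessThan_iff)
  qed
qed

definition A_end :: "link_diagram \<Rightarrow> nat \<Rightarrow> nat" where
  "A_end D r = component D {} (4 * r)"

definition A_end' :: "link_diagram \<Rightarrow> nat \<Rightarrow> nat" where
  "A_end' D r = component D {} (4 * r + 2)"

lemmas A_end_defs = A_end_def A_end'_def

lemma finite_components: "finite (components D I)"
  by (simp add: components_def)

lemma same_component_component: "(p, component D I p) \<in> same_component D I"
  unfolding component_def same_component_def by (rule LeastI[of _ p]) simp

lemma component_le: "(p, q) \<in> same_component D I \<Longrightarrow> component D I p \<le> q"
  unfolding component_def same_component_def by (rule Least_le)

lemma component_in_components: "p < 4 * ncross D + ncirc D \<Longrightarrow> component D I p \<in> components D I"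
  by (simp add: components_def)

context
  fixes D :: link_diagram
  assumes D: "is_link_diagram D"
begin

lemma component_eq_iff: "component D I p = component D I q \<longleftrightarrow> (p, q) \<in> same_component D I"
proof
  assume "component D I p = component D I q"
  then show "(p, q) \<in> same_component D I"
    using same_component_component[of p D I] same_component_component[of q D I]
      same_component_sym[OF D] same_component_trans[OF D] by metis
next
  assume pq: "(p, q) \<in> same_component D I"
  show "component D I p = component D I q"
  proof (rule antisym)
    show "component D I p \<le> component D I q"
      using pq same_component_component same_component_trans[OF D] component_le by metis
    show "component D I q \<le> component D I p"
      using same_component_sym[OF D pq] same_component_component same_component_trans[OF D] component_le
      by metis
  qed
qed

lemma A_ends: "r < ncross D \<Longrightarrow> A_end D r \<in> components D {} \<and> A_end' D r \<in> components D {}"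
  by (auto simp: A_end_defs intro!: component_in_components)

lemma component_idem [simp]: "component D I (component D I p) = component D I p"
  using component_eq_iff same_component_component same_component_sym[OF D] by metis

lemma not_connected_below_girth:
  assumes "F \<subseteq> {..<ncross D}" "r < ncross D" "r \<notin> F"
    and "enat (Suc (card F)) < mg_girth (state_graph_A D)"
  shows "(A_end D r, A_end' D r) \<notin> (edge_relation (A_end D) (A_end' D) F)\<^sup>*"
proof
  assume "(A_end D r, A_end' D r) \<in> (edge_relation (A_end D) (A_end' D) F)\<^sup>*"
  then have "mg_girth (state_graph_A D) \<le> enat (Suc (card F))"
    by (rule girth_le_if_connected)
      (use assms A_ends finite_subset in \<open>auto simp: state_graph_A_def A_end_defs\<close>)
  with assms(4) show False by simp
qed

text \<open>The circles of \<open>D(I)\<close> are the components of the subgraph with edge set I.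
  Crossings are added one by one: below the girth the new edge joins different components, so the
  new resolution is a merge described by \<open>same_component_insert\<close>.\<close>

lemma same_component_iff:
  assumes "I \<subseteq> {..<ncross D}" "enat (card I) < mg_girth (state_graph_A D)"
  shows "(p, q) \<in> same_component D I \<longleftrightarrow>
    (component D {} p, component D {} q) \<in> (edge_relation (A_end D) (A_end' D) I)\<^sup>*"
proof -
  have "finite I" using assms(1) finite_subset by blast
  then show ?thesis
    using assms
  proof (induction I arbitrary: p q rule: finite_induct)
    case empty
    then show ?case
      using component_eq_iff by (simp add: edge_relation_def)
  next
    case (insert r I)
    have less: "enat (card I) < mg_girth (state_graph_A D)"
      using insert by (metis card_insert_disjoint enat_ord_simps(2) lessI less_trans)
    have IH: "(p, q) \<in> same_component D I \<longleftrightarrow>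
        (component D {} p, component D {} q) \<in> (edge_relation (A_end D) (A_end' D) I)\<^sup>*" for p q
      using insert less by auto
    let ?R = "\<lambda>I. edge_relation (A_end D) (A_end' D) I"
    have "(A_end D r, A_end' D r) \<notin> (?R I)\<^sup>*"
      using insert by (intro not_connected_below_girth) auto
    then have "(4 * r, 4 * r + 2) \<notin> same_component D I" using IH by (simp add: A_end_defs)
    then have J: "same_component D (insert r I)
        = (state_rel D I \<union> {(4 * r, 4 * r + 2), (4 * r + 2, 4 * r)})\<^sup>*"
      using insert by (intro same_component_insert[OF D]) auto
    have mono: "(?R I)\<^sup>* \<subseteq> (?R (insert r I))\<^sup>*"
      by (intro rtrancl_mono edge_relation_mono) auto
    have IJ: "same_component D I \<subseteq> same_component D (insert r I)"
      unfolding J unfolding same_component_def by (rule rtrancl_mono) auto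
    have base: "(p, component D {} p) \<in> same_component D (insert r I)" for p
      using IH[of p "component D {} p"] IJ by auto
    note sym = same_component_sym[OF D] and trans = same_component_trans[OF D]
    show ?case
    proof
      assume "(p, q) \<in> same_component D (insert r I)"
      then show "(component D {} p, component D {} q) \<in> (?R (insert r I))\<^sup>*"
        unfolding J
      proof (induction rule: rtrancl_induct)
        case (step y z)
        have "(component D {} y, component D {} z) \<in> (?R (insert r I))\<^sup>*"
        proof (cases "(y, z) \<in> state_rel D I")
          case True
          then have "(y, z) \<in> same_component D I" by (auto simp: same_component_def)
          then show ?thesis using IH mono by auto
        next
          case False
          then show ?thesis
            using step(2) by (auto simp: edge_relation_insert A_end_defs intro!: r_into_rtrancl)
        qed
        with step(3) show ?case by (rule rtrancl_trans)
      qed simp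
    next
      assume "(component D {} p, component D {} q) \<in> (?R (insert r I))\<^sup>*"
      then have "(component D {} p, component D {} q) \<in> same_component D (insert r I)"
      proof (induction rule: rtrancl_induct)
        case (step y z)
        have "(A_end D r, A_end' D r) \<in> same_component D (insert r I)"
        proof -
          have "(4 * r, 4 * r + 2) \<in> same_component D (insert r I)" unfolding J by auto
          then show ?thesis using base[of "4 * r"] base[of "4 * r + 2"] unfolding A_end_defs by (meson sym trans)
        qed
        moreover have "(A_end D e, A_end' D e) \<in> same_component D (insert r I)" if "e \<in> I" for e
        proof -
          have "(A_end D e, A_end' D e) \<in> (?R I)\<^sup>*"
            using that by (auto simp: edge_relation_def)
          then show ?thesis using IH[of "A_end D e" "A_end' D e"] IJ by (auto simp: A_end_defs)
        qed
        ultimately have "(y, z) \<in> same_component D (insert r I)"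
          using step(2) by (auto simp: edge_relation_def intro: sym)
        with step(3) show ?case by (rule trans)
      qed (rule same_component_refl[OF D])
      then show "(p, q) \<in> same_component D (insert r I)"
        using base by (meson sym trans)
    qed
  qed
qed

text \<open>The merged circle is named by its least half-edge, hence by the smaller of the two old
  names; only the larger name disappears.\<close>

lemma components_insert:
  assumes "insert r I \<subseteq> {..<ncross D}" "r \<notin> I" "enat (card (insert r I)) < mg_girth (state_graph_A D)"
  defines "a \<equiv> component D I (4 * r)" and "b \<equiv> component D I (4 * r + 2)"
  shows "a \<noteq> b" "a \<in> components D I" "b \<in> components D I"
    and "components D (insert r I) = components D I - {max a b}"
proof -
  have fin: "finite I" using assms(1) finite_subset by auto
  have less: "enat (card I) < mg_girth (state_graph_A D)"
    using assms(2,3) fin by (metis card_insert_disjoint enat_ord_simps(2) lessI less_trans)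
  have "(A_end D r, A_end' D r) \<notin> (edge_relation (A_end D) (A_end' D) I)\<^sup>*"
    using assms fin by (intro not_connected_below_girth) auto
  then have sep: "(4 * r, 4 * r + 2) \<notin> same_component D I"
    using assms less by (subst same_component_iff) (auto simp: A_end_defs)
  then show ab: "a \<noteq> b" by (simp add: a_def b_def component_eq_iff)
  show a: "a \<in> components D I" and b: "b \<in> components D I"
    unfolding a_def b_def using assms(1) by (auto intro!: component_in_components)
  have J: "same_component D (insert r I)
      = (state_rel D I \<union> {(4 * r, 4 * r + 2), (4 * r + 2, 4 * r)})\<^sup>*"
    using assms sep by (intro same_component_insert[OF D]) auto
  have IJ: "same_component D I \<subseteq> same_component D (insert r I)"
    unfolding J unfolding same_component_def by (rule rtrancl_mono) auto
  note sym = same_component_sym[OF D] and trans = same_component_trans[OF D]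
  \<comment> \<open>The new connections identify no classes other than a and b.\<close>
  have J_imp: "component D I p = component D I q \<or>
      {component D I p, component D I q} = {a, b}"
    if "(p, q) \<in> same_component D (insert r I)" for p q
    using that unfolding J
  proof (induction rule: rtrancl_induct)
    case (step y z)
    have "component D I y = component D I z \<or> {component D I y, component D I z} = {a, b}"
    proof (cases "(y, z) \<in> state_rel D I")
      case True
      then have "(y, z) \<in> same_component D I" by (auto simp: same_component_def)
      then show ?thesis by (simp add: component_eq_iff)
    next
      case False
      then show ?thesis using step(2) by (auto simp: a_def b_def)
    qed
    with step(3) show ?case by (auto simp: doubleton_eq_iff)
  qed simp
  have abJ: "(a, b) \<in> same_component D (insert r I)"
  proof -
    have "(4 * r, 4 * r + 2) \<in> same_component D (insert r I)" unfolding J by auto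
    moreover have "(4 * r, a) \<in> same_component D (insert r I)" "(4 * r + 2, b) \<in> same_component D (insert r I)"
      unfolding a_def b_def using same_component_component IJ by auto
    ultimately show ?thesis by (meson sym trans)
  qed
  have least: "component D I' p = p \<longleftrightarrow> (\<forall>q. (p, q) \<in> same_component D I' \<longrightarrow> p \<le> q)" for I' p
    using component_le same_component_component by (metis antisym same_component_refl[OF D])
  have fix_ab: "component D I a = a" "component D I b = b" by (simp_all add: a_def b_def)
  have "component D (insert r I) p = p \<longleftrightarrow> component D I p = p \<and> p \<noteq> max a b" for p
  proof
    assume p: "component D (insert r I) p = p"
    then have p': "p \<le> q" if "(p, q) \<in> same_component D (insert r I)" for q
      using least that by blast
    have "p \<noteq> max a b" using p'[of a] p'[of b] abJ sym[OF abJ] ab by (auto simp: max_def)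
    moreover have "component D I p = p" using p' IJ by (subst least) auto
    ultimately show "component D I p = p \<and> p \<noteq> max a b" by simp
  next
    assume p: "component D I p = p \<and> p \<noteq> max a b"
    show "component D (insert r I) p = p"
      unfolding least
    proof (intro allI impI)
      fix q assume "(p, q) \<in> same_component D (insert r I)"
      then have "component D I q = p \<or> {p, component D I q} = {a, b}"
        using J_imp[of p q] p by auto
      moreover have "component D I q \<le> q" by (rule component_le) (simp add: same_component_refl[OF D])
      ultimately show "p \<le> q" using p by (auto simp: doubleton_eq_iff max_def split: if_splits)
    qed
  qed
  then show "components D (insert r I) = components D I - {max a b}"
    unfolding set_eq_iff Diff_iff mem_components_iff singleton_iff by blast
qed

text \<open>Each merge removes exactly one name. Hence the exterior algebra of \<open>D(I)\<close>
  lies in that of the all-A state, and the number of components and the size of I compensate each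
  other in \<open>qdeg\<close>.\<close>

lemma card_components:
  assumes "I \<subseteq> {..<ncross D}" "enat (card I) < mg_girth (state_graph_A D)"
  shows "components D I \<subseteq> components D {}" "card (components D I) + card I = card (components D {})"
proof -
  have "finite I" using assms(1) finite_subset by blast
  then have "components D I \<subseteq> components D {} \<and> card (components D I) + card I = card (components D {})"
    using assms
  proof (induction I rule: finite_induct)
    case (insert r I)
    have less: "enat (card I) < mg_girth (state_graph_A D)"
      using insert by (metis card_insert_disjoint enat_ord_simps(2) lessI less_trans)
    note ins = components_insert[OF insert.prems(1) insert.hyps(2) insert.prems(2)]
    have "max (component D I (4 * r)) (component D I (4 * r + 2)) \<in> components D I"
      using ins by (simp add: max_def)
    then have "card (components D I) = Suc (card (components D (insert r I)))"
      unfolding ins(4) using finite_components by (metis card_Suc_Diff1)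
    then show ?case using insert less ins(4) by auto
  qed simp
  then show "components D I \<subseteq> components D {}" "card (components D I) + card I = card (components D {})"
    by auto
qed

end

section \<open>The odd Khovanov complex below the girth\<close>

lemma keys_wedge_var:
  assumes "Poly_Mapping.keys \<omega> \<subseteq> Pow V" "a \<in> V"
  shows "Poly_Mapping.keys (wedge_var a \<omega>) \<subseteq> Pow V"
proof -
  have "Poly_Mapping.keys (wedge_var a \<omega>) \<subseteq> (\<Union>S\<in>Poly_Mapping.keys \<omega>. Poly_Mapping.keys (wedge_var a (frag_of S)))"
    unfolding ext_wedge_def ext_var_def frag_extend_of by (rule keys_frag_extend)
  also have "\<dots> \<subseteq> Pow V"
    using assms by (fastforce simp: wedge_var_monom split: if_splits)
  finally show ?thesis .
qed

lemma frag_cmul_right_cancel: "\<lbrakk>y \<noteq> 0; frag_cmul a y = frag_cmul b y\<rbrakk> \<Longrightarrow> a = b"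
  using frag_cmul_diff_distrib[of a b y] by simp

lemma edge_map_diff: "edge_map D tr I r (a - b) = edge_map D tr I r a - edge_map D tr I r b"
  by (simp add: edge_map_def Let_def ext_map_diff ext_wedge_diff_right)

lemma edge_map_zero [simp]: "edge_map D tr I r 0 = 0"
  using edge_map_diff[of D tr I r 0 0] by simp

section \<open>Summands of chains at the vertices of the hypercube\<close>

definition vertex_part :: "nat set \<Rightarrow> chain \<Rightarrow> ext" where
  "vertex_part I = frag_extend (\<lambda>(I', S). if I' = I then frag_of S else 0)"

lemma vertex_part_diff: "vertex_part I (a - b) = vertex_part I a - vertex_part I b"
  and vertex_part_cmul: "vertex_part I (frag_cmul k a) = frag_cmul k (vertex_part I a)"
  and vertex_part_sum: "finite A \<Longrightarrow> vertex_part I (sum f A) = (\<Sum>i\<in>A. vertex_part I (f i))"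
  by (simp_all add: vertex_part_def frag_extend_diff frag_extend_cmul frag_extend_sum)

lemma vertex_part_zero [simp]: "vertex_part I 0 = 0"
  by (simp add: vertex_part_def)

lemma lookup_vertex_part: "Poly_Mapping.lookup (vertex_part I c) S = Poly_Mapping.lookup c (I, S)"
proof (rule frag_induction[of c UNIV])
  fix z :: "nat set \<times> nat set"
  show "Poly_Mapping.lookup (vertex_part I (frag_of z)) S = Poly_Mapping.lookup (frag_of z) (I, S)"
    by (cases z) (auto simp: vertex_part_def)
qed (simp_all add: vertex_part_diff lookup_minus)

lemma keys_vertex_part: "Poly_Mapping.keys (vertex_part I c) = {S. (I, S) \<in> Poly_Mapping.keys c}"
  by (auto simp: in_keys_iff lookup_vertex_part)

lemma chain_eqI: "(\<And>I. vertex_part I c = vertex_part I c') \<Longrightarrow> c = c'"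
  by (rule poly_mapping_eqI) (metis lookup_vertex_part prod.exhaust)

lemma vertex_part_at_vertex: "vertex_part I (at_vertex J \<omega>) = (if I = J then \<omega> else 0)"
proof (rule frag_additive_eqI[of "\<lambda>\<omega>. vertex_part I (at_vertex J \<omega>)" "\<lambda>\<omega>. if I = J then \<omega> else 0"])
  show "vertex_part I (at_vertex J (frag_of S)) = (if I = J then frag_of S else 0)" for S
    by (simp add: at_vertex_def vertex_part_def)
qed (simp_all add: at_vertex_def frag_extend_diff vertex_part_diff)

lemma d_odd_diff: "d_odd D tr \<epsilon> (a - b) = d_odd D tr \<epsilon> a - d_odd D tr \<epsilon> b"
  by (simp add: d_odd_def frag_extend_diff)

lemma vertex_part_d_odd:
  "vertex_part J (d_odd D tr \<epsilon> c) = (\<Sum>r\<in>J \<inter> {..<ncross D}.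
     frag_cmul (\<epsilon> (J - {r}) r) (edge_map D tr (J - {r}) r (vertex_part (J - {r}) c)))"
proof (rule frag_additive_eqI[of "\<lambda>c. vertex_part J (d_odd D tr \<epsilon> c)"])
  fix z :: "nat set \<times> nat set"
  obtain I S where z: "z = (I, S)" by (cases z)
  let ?T = "\<lambda>r. frag_cmul (\<epsilon> I r) (edge_map D tr I r (frag_of S))"
  have "vertex_part J (d_odd D tr \<epsilon> (frag_of z))
      = (\<Sum>r\<in>{..<ncross D} - I. if J = insert r I then ?T r else 0)"
    by (simp add: d_odd_def z vertex_part_sum vertex_part_cmul vertex_part_at_vertex if_distrib
        cong: if_cong)
  also have "\<dots> = (\<Sum>r\<in>{..<ncross D}. if r \<notin> I \<and> J = insert r I then ?T r else 0)"
    by (rule sum.mono_neutral_cong_left) auto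
  also have "\<dots> = (\<Sum>r\<in>{..<ncross D}. if r \<in> J \<and> J - {r} = I then ?T r else 0)"
    by (rule sum.cong) auto
  also have "\<dots> = (\<Sum>r\<in>J \<inter> {..<ncross D}. if J - {r} = I then ?T r else 0)"
    by (rule sum.mono_neutral_cong_right) auto
  also have "\<dots> = (\<Sum>r\<in>J \<inter> {..<ncross D}.
     frag_cmul (\<epsilon> (J - {r}) r) (edge_map D tr (J - {r}) r (vertex_part (J - {r}) (frag_of z))))"
    by (rule sum.cong) (auto simp: z vertex_part_def)
  finally show "vertex_part J (d_odd D tr \<epsilon> (frag_of z)) = (\<Sum>r\<in>J \<inter> {..<ncross D}.
     frag_cmul (\<epsilon> (J - {r}) r) (edge_map D tr (J - {r}) r (vertex_part (J - {r}) (frag_of z))))" .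
qed (simp_all add: d_odd_diff vertex_part_diff edge_map_diff frag_cmul_diff sum_subtractf)

section \<open>Embedding the complex into the exterior algebra on the all-A components\<close>

context
  fixes D :: link_diagram
  assumes D: "is_link_diagram D"
begin

interpretation graph_operators "{..<ncross D}" "A_end D" "A_end' D" "mg_girth (state_graph_A D)"
  unfolding graph_operators_def
  by (rule edge_ops_anticommuting) (use not_connected_below_girth[OF D] in auto)

abbreviation (input) state_op where
  "state_op \<equiv> edge_op (A_end D) (A_end' D)"

abbreviation (input) joined where
  "joined I \<equiv> (edge_relation (A_end D) (A_end' D) I)\<^sup>*"

lemma joined_component:
  assumes "I \<subseteq> {..<ncross D}" "enat (card I) < mg_girth (state_graph_A D)"
    and "p < 4 * ncross D + ncirc D"
  shows "(component D {} p, component D I p) \<in> joined I"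
proof -
  have "component D I p \<in> components D {}"
    using card_components(1)[OF D assms(1,2)] component_in_components[OF assms(3)] by blast
  then have "component D {} (component D I p) = component D I p"
    by (simp add: mem_components_iff)
  moreover have "(component D {} p, component D {} (component D I p)) \<in> joined I"
    using same_component_component[of p D I] same_component_iff[OF D assms(1,2)] by simp
  ultimately show ?thesis by simp
qed

lemma product_ext_map_component:
  assumes "I \<subseteq> {..<ncross D}" "enat (card I) < mg_girth (state_graph_A D)"
    and "Poly_Mapping.keys \<omega> \<subseteq> Pow (components D {})"
  shows "product I (ext_map (component D I) \<omega>) = product I \<omega>"
proof (rule product_ext_map)
  show "finite I" using assms(1) finite_subset by blast
  fix a assume "a \<in> components D {}"
  then have "a < 4 * ncross D + ncirc D" "component D {} a = a" by (simp_all add: mem_components_iff)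
  then show "(a, component D I a) \<in> joined I" using joined_component[OF assms(1,2), of a] by simp
qed (use assms(3) finite_components in auto)

text \<open>Below the girth the edge map is a merge, so it only renames variables within components
  of the graph with edges \<open>insert r I\<close>, which the product does not notice.\<close>

lemma product_edge_map:
  assumes "insert r I \<subseteq> {..<ncross D}" "r \<notin> I" "enat (card (insert r I)) < mg_girth (state_graph_A D)"
    and "Poly_Mapping.keys \<omega> \<subseteq> Pow (components D I)"
  shows "product (insert r I) (edge_map D tr I r \<omega>) = product (insert r I) \<omega>"
    and "Poly_Mapping.keys (edge_map D tr I r \<omega>) \<subseteq> Pow (components D (insert r I))"
proof -
  have fin: "finite I" using assms(1) finite_subset by auto
  have less: "enat (card I) < mg_girth (state_graph_A D)"
    using assms(2,3) fin by (metis card_insert_disjoint enat_ord_simps(2) lessI less_trans)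
  have sub: "components D I \<subseteq> components D {}"
    using card_components(1)[OF D _ less] assms(1) by auto
  have em: "edge_map D tr I r \<omega> = ext_map (component D (insert r I)) \<omega>"
    using components_insert(1)[OF D assms(1-3)] by (simp add: edge_map_def)
  show "product (insert r I) (edge_map D tr I r \<omega>) = product (insert r I) \<omega>"
    unfolding em using assms sub by (intro product_ext_map_component) auto
  have "Poly_Mapping.keys (edge_map D tr I r \<omega>)
      \<subseteq> {S. S \<subseteq> component D (insert r I) ` components D I \<and> True}"
    unfolding em using assms(4) finite_components by (intro keys_ext_map) auto
  moreover have "component D (insert r I) ` components D I \<subseteq> components D (insert r I)"
    by (auto simp: mem_components_iff[of _ D I] intro: component_in_components)
  ultimately show "Poly_Mapping.keys (edge_map D tr I r \<omega>) \<subseteq> Pow (components D (insert r I))"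
    by auto
qed

text \<open>Injectivity of the embedding. Up to sign the last factor is \<open>x\<^sub>r\<close>,
  whose ends may be replaced by the components a and b of \<open>D(I)\<close> to be merged. By
  induction, wedging with the variables of a and b gives the same result; as the larger of a and b
  does not occur in \<open>\<omega>\<close>, interior product with it recovers
  \<open>\<omega>\<close> up to sign.\<close>

lemma product_eq_0_imp:
  assumes "I \<subseteq> {..<ncross D}" "enat (card I) < mg_girth (state_graph_A D)"
    and "Poly_Mapping.keys \<omega> \<subseteq> Pow (components D I)" "product I \<omega> = 0"
  shows "\<omega> = 0"
proof -
  have "finite I" using assms(1) finite_subset by blast
  then show ?thesis
    using assms
  proof (induction I arbitrary: \<omega> rule: finite_induct)
    case (insert r I)
    have less: "enat (card I) < mg_girth (state_graph_A D)"
      using insert by (metis card_insert_disjoint enat_ord_simps(2) lessI less_trans)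
    have I: "I \<subseteq> {..<ncross D}" and r: "r < ncross D" using insert.prems by auto
    define a where "a = component D I (4 * r)"
    define b where "b = component D I (4 * r + 2)"
    note ins = components_insert[OF D insert.prems(1) insert.hyps(2) insert.prems(2), folded a_def b_def]
    obtain \<sigma> where \<sigma>: "\<sigma> \<in> {1, -1}"
      "\<And>a. product (insert r I) a = frag_cmul \<sigma> (state_op r (product I a))"
      using product_insert[OF insert.hyps(1,2)] by auto
    have "state_op r (product I \<omega>) = 0" using \<sigma> insert.prems(4) by auto
    moreover have "wedge_var (A_end D r) (product I \<omega>) = wedge_var a (product I \<omega>)"
      by (rule wedge_var_product_connected)
        (use r insert.hyps joined_component[OF I less, of "4 * r"] in \<open>simp_all add: a_def A_end_def\<close>)
    moreover have "wedge_var (A_end' D r) (product I \<omega>) = wedge_var b (product I \<omega>)"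
      by (rule wedge_var_product_connected)
        (use r insert.hyps joined_component[OF I less, of "4 * r + 2"] in \<open>simp_all add: b_def A_end'_def\<close>)
    ultimately have "wedge_var a (product I \<omega>) = wedge_var b (product I \<omega>)"
      by (simp add: edge_op_def)
    then have "product I (wedge_var a \<omega> - wedge_var b \<omega>) = 0"
      by (simp add: product_diff wedge_var_product)
    moreover have "Poly_Mapping.keys \<omega> \<subseteq> Pow (components D I)"
      using insert.prems(3) ins(4) by auto
    then have "Poly_Mapping.keys (wedge_var a \<omega> - wedge_var b \<omega>) \<subseteq> Pow (components D I)"
      using keys_wedge_var ins(2,3) by (intro order_trans[OF keys_diff] Un_least) auto
    ultimately have ab: "wedge_var a \<omega> - wedge_var b \<omega> = 0"
      using insert.IH I less by blast
    have "contract_var (max a b) \<omega> = 0"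
      using insert.prems(3) ins(4) by (intro contract_var_eq_0) auto
    then have "contract_var (max a b) (wedge_var a \<omega> - wedge_var b \<omega>) = (if a < b then - \<omega> else \<omega>)"
      using ins(1) by (auto simp: contract_var_diff contract_var_wedge_var max_def)
    with ab show ?case by (auto split: if_splits)
  qed simp
qed

context
  fixes tr :: "nat \<Rightarrow> bool" and \<epsilon> :: "nat set \<Rightarrow> nat \<Rightarrow> int"
  assumes \<epsilon>: "is_sign_assignment D tr \<epsilon>"
begin

text \<open>
  On forests the edge maps are wedge products with \<open>x\<^sub>r\<close> up to sign. As the latter already
  anticommute, the signs relating them to the signed edge maps form a cocycle.
\<close>

lemma edge_signs:
  assumes "enat k < mg_girth (state_graph_A D)"
  shows "\<exists>\<tau> :: nat set \<Rightarrow> int. (\<forall>I. I \<subseteq> {..<ncross D} \<longrightarrow> card I \<le> k \<longrightarrow> \<tau> I * \<tau> I = 1) \<and>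
    (\<forall>I r \<omega>. I \<subseteq> {..<ncross D} \<longrightarrow> r \<in> {..<ncross D} - I \<longrightarrow> card I < k \<longrightarrow>
       Poly_Mapping.keys \<omega> \<subseteq> Pow (components D I) \<longrightarrow>
       frag_cmul (\<epsilon> I r) (product (insert r I) (edge_map D tr I r \<omega>))
       = frag_cmul (\<tau> I * \<tau> (insert r I)) (state_op r (product I \<omega>)))"
proof -
  let ?E = "{..<ncross D}"
  have fin: "finite I" if "I \<subseteq> ?E" for I using that finite_subset by blast
  have less: "enat (card I) < mg_girth (state_graph_A D)" if "card I \<le> k" for I :: "nat set"
    using that assms by (meson enat_ord_simps(1) le_less_trans)
  obtain \<sigma> where "\<forall>I r. finite I \<and> r \<notin> I \<longrightarrow> \<sigma> I r \<in> {1, -1 :: int} \<and>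
      (\<forall>a. product (insert r I) a = frag_cmul (\<sigma> I r) (state_op r (product I a)))"
    using product_insert by metis
  then have \<sigma>: "\<sigma> I r \<in> {1, -1}"
    "product (insert r I) a = frag_cmul (\<sigma> I r) (state_op r (product I a))"
    if "I \<subseteq> ?E" "r \<in> ?E - I" for I r a
    using that fin by auto
  have \<epsilon>_unit: "\<epsilon> I r \<in> {1, -1}" if "I \<subseteq> ?E" "r \<in> ?E - I" for I r
    using \<epsilon> that unfolding is_sign_assignment_def by blast
  have pem: "product (insert r I) (edge_map D tr I r \<omega>) = frag_cmul (\<sigma> I r) (state_op r (product I \<omega>))"
    if "I \<subseteq> ?E" "r \<in> ?E - I" "card I < k" "Poly_Mapping.keys \<omega> \<subseteq> Pow (components D I)" for I r \<omega>
  proof -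
    have "product (insert r I) (edge_map D tr I r \<omega>) = product (insert r I) \<omega>"
      using that fin by (intro product_edge_map(1) less) auto
    then show ?thesis using \<sigma>(2)[OF that(1,2)] by simp
  qed
  have square: "(\<epsilon> (insert r I) t * \<sigma> (insert r I) t) * (\<epsilon> I r * \<sigma> I r)
      = (\<epsilon> (insert t I) r * \<sigma> (insert t I) r) * (\<epsilon> I t * \<sigma> I t)"
    if I: "I \<subseteq> ?E" "r \<in> ?E - I" "t \<in> ?E - I" "r \<noteq> t" "card I + 2 \<le> k" for I r t
  proof -
    \<comment> \<open>Signs are compared on the unit of the exterior algebra. Both ways around the
      square send it, after embedding, to a multiple of y, which is nonzero by injectivity of the
      embedding for K.\<close>
    let ?\<omega> = "frag_of {} :: ext"
    define K where "K = insert t (insert r I)"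
    define y where "y = state_op t (state_op r (product I ?\<omega>))"
    have path: "product K (edge_map D tr (insert p I) q (edge_map D tr I p ?\<omega>))
        = frag_cmul (\<sigma> (insert p I) q * \<sigma> I p) (state_op q (state_op p (product I ?\<omega>)))"
      if "p \<in> ?E - I" "q \<in> ?E - I" "p \<noteq> q" "K = insert q (insert p I)" for p q
    proof -
      have c: "card (insert p I) < k" "card I < k" "insert p I \<subseteq> ?E" "q \<in> ?E - insert p I"
        using that I fin[OF I(1)] by auto
      have "Poly_Mapping.keys (edge_map D tr I p ?\<omega>) \<subseteq> Pow (components D (insert p I))"
        using that c by (intro product_edge_map(2) less) auto
      then show ?thesis
        unfolding that(4) using pem[OF c(3,4,1)] pem[OF I(1) that(1) c(2), of ?\<omega>]
        by (simp add: op_cmul)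
    qed
    have "y \<noteq> 0"
    proof
      assume "y = 0"
      moreover have "product K ?\<omega> = frag_cmul (\<sigma> (insert r I) t * \<sigma> I r) y"
        unfolding K_def y_def using I by (simp add: \<sigma>(2) op_cmul)
      ultimately have K0: "product K ?\<omega> = 0" by simp
      have "K \<subseteq> ?E" using I by (auto simp: K_def)
      moreover have "card K \<le> k" using I fin[OF I(1)] by (simp add: K_def card_insert_if)
      ultimately have "?\<omega> = 0"
        by (rule product_eq_0_imp[OF _ less _ K0]) simp
      then show False by simp
    qed
    moreover have "frag_cmul (\<epsilon> (insert r I) t * \<epsilon> I r) (edge_map D tr (insert r I) t (edge_map D tr I r ?\<omega>))
        = - frag_cmul (\<epsilon> (insert t I) r * \<epsilon> I t) (edge_map D tr (insert t I) r (edge_map D tr I t ?\<omega>))"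
      using \<epsilon> I unfolding is_sign_assignment_def ext_carrier_def by simp
    \<comment> \<open>The minus sign of the anticommuting square cancels against that of the
      anticommuting operators, which leaves a multiplicative cocycle condition.\<close>
    from arg_cong[OF this, of "product K"]
    have "frag_cmul (\<epsilon> (insert r I) t * \<epsilon> I r * (\<sigma> (insert r I) t * \<sigma> I r)) y
        = frag_cmul (\<epsilon> (insert t I) r * \<epsilon> I t * (\<sigma> (insert t I) r * \<sigma> I t)) y"
      using path[of r t] path[of t r] I
      by (simp add: K_def insert_commute y_def op_anticommute[of r t] product_cmul frag_cmul_uminus)
    ultimately have "\<epsilon> (insert r I) t * \<epsilon> I r * (\<sigma> (insert r I) t * \<sigma> I r)
        = \<epsilon> (insert t I) r * \<epsilon> I t * (\<sigma> (insert t I) r * \<sigma> I t)"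
      by (rule frag_cmul_right_cancel)
    then show ?thesis by (simp only: mult_ac)
  qed
  have "\<exists>\<tau>. (\<forall>I. I \<subseteq> ?E \<longrightarrow> card I \<le> k \<longrightarrow> \<tau> I \<in> {1, -1 :: int}) \<and>
      (\<forall>I r. I \<subseteq> ?E \<longrightarrow> r \<in> ?E - I \<longrightarrow> card I < k \<longrightarrow> \<epsilon> I r * \<sigma> I r = \<tau> I * \<tau> (insert r I))"
  proof (rule sign_cocycle_is_coboundary)
    show "\<epsilon> I r * \<sigma> I r \<in> {1, -1}" if "I \<subseteq> ?E" "r \<in> ?E - I" for I r
      using \<epsilon>_unit[OF that] \<sigma>(1)[OF that] by auto
  qed (use square in auto)
  then obtain \<tau> where \<tau>: "\<And>I. \<lbrakk>I \<subseteq> ?E; card I \<le> k\<rbrakk> \<Longrightarrow> \<tau> I \<in> {1, -1 :: int}"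
    "\<And>I r. \<lbrakk>I \<subseteq> ?E; r \<in> ?E - I; card I < k\<rbrakk> \<Longrightarrow> \<epsilon> I r * \<sigma> I r = \<tau> I * \<tau> (insert r I)"
    by blast
  have "\<tau> I * \<tau> I = 1" if "I \<subseteq> ?E" "card I \<le> k" for I
    using \<tau>(1)[OF that] by auto
  moreover have "frag_cmul (\<epsilon> I r) (product (insert r I) (edge_map D tr I r \<omega>))
       = frag_cmul (\<tau> I * \<tau> (insert r I)) (state_op r (product I \<omega>))"
    if "I \<subseteq> ?E" "r \<in> ?E - I" "card I < k" "Poly_Mapping.keys \<omega> \<subseteq> Pow (components D I)" for I r \<omega>
    using pem[OF that] \<tau>(2)[OF that(1-3)] by simp
  ultimately show ?thesis by (intro exI[of _ \<tau>]) blast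
qed

text \<open>With the embedding at F multiplied by \<open>\<tau> F\<close>, the differential becomes
  \<open>codiff\<close>; the outer factor \<open>\<tau> N\<close> undoes the twist at the
  target.\<close>

lemma product_d_odd:
  assumes k: "enat k < mg_girth (state_graph_A D)"
    and sign: "\<forall>I r \<omega>. I \<subseteq> {..<ncross D} \<longrightarrow> r \<in> {..<ncross D} - I \<longrightarrow> card I < k \<longrightarrow>
       Poly_Mapping.keys \<omega> \<subseteq> Pow (components D I) \<longrightarrow>
       frag_cmul (\<epsilon> I r) (product (insert r I) (edge_map D tr I r \<omega>))
       = frag_cmul (\<tau> I * \<tau> (insert r I)) (state_op r (product I \<omega>))"
    and a: "Poly_Mapping.keys a \<subseteq> {(I, S). S \<subseteq> components D I}"
    and N: "N \<subseteq> {..<ncross D}" "card N = k"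
  shows "product N (vertex_part N (d_odd D tr \<epsilon> a))
      = frag_cmul (\<tau> N) (codiff (\<lambda>F. frag_cmul (\<tau> F) (product F (vertex_part F a))) N)"
    and "Poly_Mapping.keys (vertex_part N (d_odd D tr \<epsilon> a)) \<subseteq> Pow (components D N)"
proof -
  have fin: "finite N" using N(1) finite_subset by blast
  have NE: "N \<inter> {..<ncross D} = N" using N(1) by auto
  have keys: "Poly_Mapping.keys (vertex_part F a) \<subseteq> Pow (components D F)" for F
    using a by (auto simp: keys_vertex_part)
  have F: "N - {r} \<subseteq> {..<ncross D}" "r \<in> {..<ncross D} - (N - {r})" "card (N - {r}) < k"
    "insert r (N - {r}) = N" if "r \<in> N" for r
    using that N card_Diff1_less[OF fin that] by auto
  show "product N (vertex_part N (d_odd D tr \<epsilon> a))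
      = frag_cmul (\<tau> N) (codiff (\<lambda>F. frag_cmul (\<tau> F) (product F (vertex_part F a))) N)"
    unfolding vertex_part_d_odd NE product_sum product_cmul codiff_def frag_cmul_sum op_cmul
  proof (rule sum.cong, simp)
    fix r assume r: "r \<in> N"
    show "frag_cmul (\<epsilon> (N - {r}) r) (product N (edge_map D tr (N - {r}) r (vertex_part (N - {r}) a)))
        = frag_cmul (\<tau> N) (frag_cmul (\<tau> (N - {r})) (state_op r (product (N - {r}) (vertex_part (N - {r}) a))))"
      using sign[rule_format, OF F(1-3)[OF r] keys] by (simp only: F(4)[OF r] frag_cmul_cmul mult.commute)
  qed
  show "Poly_Mapping.keys (vertex_part N (d_odd D tr \<epsilon> a)) \<subseteq> Pow (components D N)"
    unfolding vertex_part_d_odd NE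
  proof (rule order_trans[OF keys_sum], rule UN_least, rule order_trans[OF keys_cmul])
    fix r assume r: "r \<in> N"
    have "Poly_Mapping.keys (edge_map D tr (N - {r}) r (vertex_part (N - {r}) a))
        \<subseteq> Pow (components D (insert r (N - {r})))"
      using F[OF r] k N by (intro product_edge_map(2) keys) auto
    then show "Poly_Mapping.keys (edge_map D tr (N - {r}) r (vertex_part (N - {r}) a)) \<subseteq> Pow (components D N)"
      by (simp only: F(4)[OF r])
  qed
qed

text \<open>The equation is embedded and solved by \<open>codiff_image_saturated\<close>. The
  solution is then lifted through the products by \<open>ann_imp_product\<close>, made homogeneous,
  and rewritten in the components of the states; injectivity of the embedding shows that it solves
  the original equation.\<close>

lemma d_odd_image_saturated:
  assumes k: "enat k < mg_girth (state_graph_A D)" "int k = i + int (c_minus D)"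
    and c: "c \<in> carrier (CKh_odd D i j)" and b: "b \<in> carrier (CKh_odd D (i - 1) j)"
    and m: "0 < m" "frag_cmul m c = d_odd D tr \<epsilon> b"
  shows "\<exists>a \<in> carrier (CKh_odd D (i - 1) j). c = d_odd D tr \<epsilon> a"
\<comment> \<open>For nonzero c the exterior degree s can be read off from any of its monomials,
  since it is determined by j.\<close>
proof (cases "c = 0")
  case True
  then show ?thesis by (intro bexI[of _ 0]) (simp_all add: CKh_odd_def d_odd_def)
next
  case False
  let ?E = "{..<ncross D}"
  let ?V = "components D {}"
  have fin: "finite I" if "I \<subseteq> ?E" for I using that finite_subset by blast
  have less: "enat (card I) < mg_girth (state_graph_A D)" if "card I \<le> k" for I :: "nat set"
    using that k by (meson enat_ord_simps(1) le_less_trans)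
  have ends: "A_end D r \<in> ?V" "A_end' D r \<in> ?V" if "r < ncross D" for r
    using A_ends[OF D that] by auto
  have c_keys: "I \<subseteq> ?E \<and> S \<subseteq> components D I \<and> card I = k \<and> qdeg D I S = j"
    if "(I, S) \<in> Poly_Mapping.keys c" for I S
    using that c k by (auto simp: CKh_odd_def hdeg_def)
  have b_keys: "I \<subseteq> ?E \<and> S \<subseteq> components D I \<and> Suc (card I) = k"
    if "(I, S) \<in> Poly_Mapping.keys b" for I S
    using that b k by (auto simp: CKh_odd_def hdeg_def)
  \<comment> \<open>By \<open>card_components\<close>, the polynomial degree depends only on the
    exterior degree in this range.\<close>
  have qdeg_eq: "qdeg D I S = int (card ?V) - 2 * int (card S) + int (c_plus D) - 2 * int (c_minus D)"
    if "I \<subseteq> ?E" "card I \<le> k" for I S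
    using card_components(2)[OF D that(1) less[OF that(2)]] by (simp add: qdeg_def)
  obtain I0 S0 where "(I0, S0) \<in> Poly_Mapping.keys c"
    using False by (metis all_not_in_conv keys_eq_empty prod.exhaust)
  then have j: "j = int (card ?V) - 2 * int (card S0) + int (c_plus D) - 2 * int (c_minus D)"
    using c_keys[of I0 S0] qdeg_eq[of I0 S0] by auto
  define s where "s = card S0"
  obtain \<tau> where \<tau>: "\<And>I. \<lbrakk>I \<subseteq> ?E; card I \<le> k\<rbrakk> \<Longrightarrow> \<tau> I * \<tau> I = 1"
    and sign: "\<forall>I r \<omega>. I \<subseteq> {..<ncross D} \<longrightarrow> r \<in> {..<ncross D} - I \<longrightarrow> card I < k \<longrightarrow>
       Poly_Mapping.keys \<omega> \<subseteq> Pow (components D I) \<longrightarrow>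
       frag_cmul (\<epsilon> I r) (product (insert r I) (edge_map D tr I r \<omega>))
       = frag_cmul (\<tau> I * \<tau> (insert r I)) (state_op r (product I \<omega>))"
    using edge_signs[OF k(1)] by blast
  note product_d = product_d_odd[OF k(1) sign]
  define \<beta> where "\<beta> F = frag_cmul (\<tau> F) (product F (vertex_part F b))" for F
  define \<gamma> where "\<gamma> N = frag_cmul (\<tau> N) (product N (vertex_part N c))" for N
  have "\<exists>\<alpha>. (\<forall>F. F \<subseteq> ?E \<longrightarrow> Suc (card F) = k \<longrightarrow> \<alpha> F \<in> ann (F \<union> {})) \<and>
      (\<forall>N. N \<subseteq> ?E \<longrightarrow> card N = k \<longrightarrow> \<gamma> N = codiff \<alpha> N)"
  proof (rule codiff_image_saturated)
    show "\<beta> F \<in> ann (F \<union> {})" "\<gamma> F \<in> ann (F \<union> {})" if "F \<subseteq> ?E" for F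
      using that fin by (auto simp: \<beta>_def \<gamma>_def intro!: ann_cmul product_ann)
    show "frag_cmul m (\<gamma> N) = codiff \<beta> N" if N: "N \<subseteq> ?E" "card N = k" for N
    proof -
      have "frag_cmul m (\<gamma> N) = frag_cmul (\<tau> N) (product N (vertex_part N (d_odd D tr \<epsilon> b)))"
        by (simp add: \<gamma>_def flip: m(2)) (simp add: vertex_part_cmul product_cmul mult.commute)
      also have "\<dots> = frag_cmul (\<tau> N * \<tau> N) (codiff \<beta> N)"
        using N b_keys by (subst product_d(1)) (auto simp: \<beta>_def[abs_def])
      finally show ?thesis using \<tau> N by simp
    qed
  qed (use k m in auto)
  then obtain \<alpha> where \<alpha>: "\<And>F. \<lbrakk>F \<subseteq> ?E; Suc (card F) = k\<rbrakk> \<Longrightarrow> \<alpha> F \<in> ann F"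
    and \<gamma>_\<alpha>: "\<And>N. \<lbrakk>N \<subseteq> ?E; card N = k\<rbrakk> \<Longrightarrow> \<gamma> N = codiff \<alpha> N"
    by auto
  have "\<exists>\<omega>. \<alpha> F = product F \<omega>" if "F \<subseteq> ?E" "Suc (card F) = k" for F
    using that \<alpha> by (intro ann_imp_product less) auto
  then obtain \<omega> where \<omega>: "\<And>F. \<lbrakk>F \<subseteq> ?E; Suc (card F) = k\<rbrakk> \<Longrightarrow> \<alpha> F = product F (\<omega> F)"
    by metis
  \<comment> \<open>The lift \<open>\<omega> F\<close> lies in the exterior algebra on all natural
    numbers. Its degree s part on the all-A components is taken, and these are then merged to
    components of \<open>D(F)\<close>.\<close>
  define \<rho> where "\<rho> F = frag_cmul (\<tau> F) (ext_map (component D F) (graded_part ?V s (\<omega> F)))" for F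
  define Fs where "Fs = {F. F \<subseteq> ?E \<and> Suc (card F) = k}"
  have finFs: "finite Fs" unfolding Fs_def by (rule finite_subset[of _ "Pow ?E"]) auto
  define a where "a = (\<Sum>F\<in>Fs. at_vertex F (\<rho> F))"
  have part_a: "vertex_part F a = (if F \<in> Fs then \<rho> F else 0)" for F
    using finFs by (simp add: a_def vertex_part_sum vertex_part_at_vertex)
  have keys_\<rho>: "Poly_Mapping.keys (\<rho> F) \<subseteq> {S. S \<subseteq> components D F \<and> card S = s}" for F
  proof -
    have "Poly_Mapping.keys (ext_map (component D F) (graded_part ?V s (\<omega> F)))
        \<subseteq> {S. S \<subseteq> component D F ` ?V \<and> card S = s}"
      using keys_graded_part finite_components by (rule keys_ext_map)
    moreover have "component D F ` ?V \<subseteq> components D F"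
      by (auto simp: mem_components_iff[of _ D "{}"] intro: component_in_components)
    ultimately have "Poly_Mapping.keys (ext_map (component D F) (graded_part ?V s (\<omega> F)))
        \<subseteq> {S. S \<subseteq> components D F \<and> card S = s}"
      by blast
    then show ?thesis
      unfolding \<rho>_def by (rule order_trans[OF keys_cmul])
  qed
  have a_keys: "I \<in> Fs \<and> S \<subseteq> components D I \<and> card S = s" if "(I, S) \<in> Poly_Mapping.keys a" for I S
  proof -
    have "S \<in> Poly_Mapping.keys (vertex_part I a)" using that by (simp add: keys_vertex_part)
    then show ?thesis using keys_\<rho>[of I] by (auto simp: part_a split: if_splits)
  qed
  have a_carrier: "a \<in> carrier (CKh_odd D (i - 1) j)"
  proof -
    have "I \<subseteq> ?E \<and> S \<subseteq> components D I \<and> hdeg D I = i - 1 \<and> qdeg D I S = j"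
      if "(I, S) \<in> Poly_Mapping.keys a" for I S
      using a_keys[OF that] k(2) qdeg_eq[of I S] j by (auto simp: Fs_def hdeg_def s_def)
    then show ?thesis
      unfolding CKh_odd_def carrier_free_Abelian_group_iff by blast
  qed
  \<comment> \<open>Merging is invisible to the product, and the product raises degrees by
    \<open>card F\<close>.\<close>
  have \<rho>_\<alpha>: "frag_cmul (\<tau> F) (product F (\<rho> F)) = graded_part ?V (s + card F) (\<alpha> F)" if "F \<in> Fs" for F
  proof -
    have F: "F \<subseteq> ?E" "Suc (card F) = k" using that by (auto simp: Fs_def)
    have "product F (ext_map (component D F) (graded_part ?V s (\<omega> F))) = product F (graded_part ?V s (\<omega> F))"
    proof (rule product_ext_map_component[OF F(1) less])
      show "card F \<le> k" using F(2) by simp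
      show "Poly_Mapping.keys (graded_part ?V s (\<omega> F)) \<subseteq> Pow ?V"
        using keys_graded_part[of ?V s "\<omega> F"] by blast
    qed
    also have "\<dots> = graded_part ?V (s + card F) (product F (\<omega> F))"
      using F fin ends by (intro graded_part_product[symmetric] finite_components) auto
    finally show ?thesis
      using F \<tau>[of F] by (simp add: \<rho>_def product_cmul \<omega>)
  qed
  have "c = d_odd D tr \<epsilon> a"
  proof (rule chain_eqI)
    fix N
    show "vertex_part N c = vertex_part N (d_odd D tr \<epsilon> a)"
    proof (cases "N \<subseteq> ?E \<and> card N = k")
      case False
      have "Poly_Mapping.keys (vertex_part N c) = {}"
        using False c_keys unfolding keys_vertex_part by blast
      then have "vertex_part N c = 0" by simp
      moreover have "vertex_part (N - {r}) a = 0" if "r \<in> N \<inter> ?E" for r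
      proof -
        have "N - {r} \<notin> Fs"
        proof
          assume "N - {r} \<in> Fs"
          then have *: "N - {r} \<subseteq> ?E" "Suc (card (N - {r})) = k" by (simp_all only: Fs_def mem_Collect_eq)
          from fin[OF *(1)] have "finite N" by simp
          then have "card N = Suc (card (N - {r}))" using that by (simp add: card_Suc_Diff1 del: card_Diff_insert)
          then have "card N = k" using *(2) by (rule trans)
          moreover have "N \<subseteq> ?E" using *(1) that by blast
          ultimately show False using False by blast
        qed
        then show ?thesis by (simp add: part_a)
      qed
      ultimately show ?thesis by (simp add: vertex_part_d_odd)
    next
      case True
      then have N: "N \<subseteq> ?E" "card N = k" by auto
      have Nr: "N - {r} \<in> Fs" if "r \<in> N" for r
        using that N fin[OF N(1)] by (auto simp: Fs_def card_Suc_Diff1 simp del: card_Diff_insert)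
      have keys_a: "Poly_Mapping.keys a \<subseteq> {(I, S). S \<subseteq> components D I}" using a_keys by blast
      have c_part: "Poly_Mapping.keys (vertex_part N c) \<subseteq> {S. S \<subseteq> ?V \<and> card S = s}"
      proof
        fix S assume "S \<in> Poly_Mapping.keys (vertex_part N c)"
        then have "S \<subseteq> components D N" "qdeg D N S = j" using c_keys by (auto simp: keys_vertex_part)
        then show "S \<in> {S. S \<subseteq> ?V \<and> card S = s}"
          using qdeg_eq[of N S] N j card_components(1)[OF D N(1) less] by (auto simp: s_def)
      qed
      have "codiff (\<lambda>F. frag_cmul (\<tau> F) (product F (vertex_part F a))) N
          = (\<Sum>r\<in>N. state_op r (graded_part ?V (s + card (N - {r})) (\<alpha> (N - {r}))))"
        unfolding codiff_def using Nr by (intro sum.cong) (auto simp: part_a \<rho>_\<alpha>)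
      also have "\<dots> = (\<Sum>r\<in>N. graded_part ?V (s + k) (state_op r (\<alpha> (N - {r}))))"
      proof (rule sum.cong, simp)
        fix r assume r: "r \<in> N"
        have "Suc (s + card (N - {r})) = s + k" using Nr[OF r] by (simp add: Fs_def)
        then show "state_op r (graded_part ?V (s + card (N - {r})) (\<alpha> (N - {r})))
            = graded_part ?V (s + k) (state_op r (\<alpha> (N - {r})))"
          using graded_part_edge_op[of ?V r "s + card (N - {r})"] ends r N(1) finite_components by auto
      qed
      also have "\<dots> = graded_part ?V (s + k) (codiff \<alpha> N)"
        using fin[OF N(1)] by (simp add: codiff_def graded_part_def frag_extend_sum)
      also have "\<dots> = frag_cmul (\<tau> N) (graded_part ?V (s + card N) (product N (vertex_part N c)))"
        using \<gamma>_\<alpha>[OF N] N by (simp add: \<gamma>_def graded_part_cmul flip: \<gamma>_\<alpha>)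
      \<comment> \<open>All monomials of c have degree s, so passing to the homogeneous part has no
        effect on its image.\<close>
      also have "\<dots> = frag_cmul (\<tau> N) (product N (vertex_part N c))"
        using N fin ends c_part
        by (subst graded_part_product) (auto simp: finite_components graded_part_id)
      finally have "product N (vertex_part N (d_odd D tr \<epsilon> a)) = product N (vertex_part N c)"
        using product_d(1)[OF keys_a N] \<tau>[of N] N by simp
      then have "product N (vertex_part N c - vertex_part N (d_odd D tr \<epsilon> a)) = 0"
        by (simp add: product_diff)
      moreover have "Poly_Mapping.keys (vertex_part N c - vertex_part N (d_odd D tr \<epsilon> a)) \<subseteq> Pow (components D N)"
      proof (rule order_trans[OF keys_diff], rule Un_least[OF _ product_d(2)[OF keys_a N]])
        show "Poly_Mapping.keys (vertex_part N c) \<subseteq> Pow (components D N)"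
          using c_keys unfolding keys_vertex_part by blast
      qed
      ultimately have "vertex_part N c - vertex_part N (d_odd D tr \<epsilon> a) = 0"
        using product_eq_0_imp[OF N(1) less] N(2) by blast
      then show ?thesis by simp
    qed
  qed
  with a_carrier show ?thesis by blast
qed

end
end

text \<open>The m-th power of the class of z is the coset of m z, which is trivial exactly if m z
  lies in the image of d. So a saturated image leaves no torsion. The powers are computed directly
  as sums of sets.\<close>

lemma torsion_free_quotient:
  fixes S :: "'a set" and Z :: "('a \<Rightarrow>\<^sub>0 int) set" and d :: "('b \<Rightarrow>\<^sub>0 int) \<Rightarrow> ('a \<Rightarrow>\<^sub>0 int)"
  assumes "\<And>a b. d (a - b) = d a - d b"
    and sat: "\<And>c m. \<lbrakk>c \<in> Z; 0 < m; frag_cmul (int m) c \<in> d ` carrier (free_Abelian_group T)\<rbrakk> \<Longrightarrow>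
      c \<in> d ` carrier (free_Abelian_group T)"
  shows "torsion_free ((free_Abelian_group S) \<lparr> carrier := Z \<rparr> Mod (d ` carrier (free_Abelian_group T)))"
proof -
  let ?H = "d ` carrier (free_Abelian_group T)"
  let ?G = "(free_Abelian_group S) \<lparr> carrier := Z \<rparr>"
  have H0: "0 \<in> ?H" using assms(1)[of 0 0] by (intro image_eqI[of _ _ 0]) auto
  have Hdiff: "x - y \<in> ?H" if "x \<in> ?H" "y \<in> ?H" for x y
  proof -
    from that obtain a b where ab: "a \<in> carrier (free_Abelian_group T)" "b \<in> carrier (free_Abelian_group T)"
      "x = d a" "y = d b" by blast
    then have "a - b \<in> carrier (free_Abelian_group T)"
      using keys_diff[of a b] by auto
    then show ?thesis using ab assms(1) by (metis imageI)
  qed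
  have Hadd: "x + y \<in> ?H" if "x \<in> ?H" "y \<in> ?H" for x y
    using Hdiff[OF that(1) Hdiff[OF H0 that(2)]] by simp
  have coset: "?H #>\<^bsub>?G\<^esub> z = (\<lambda>h. h + z) ` ?H" for z
    by (auto simp: r_coset_def)
  have mult: "X \<otimes>\<^bsub>?G Mod ?H\<^esub> Y = {x + y | x y. x \<in> X \<and> y \<in> Y}" for X Y
    by (auto simp: FactGroup_def set_mult_def)
  have pow: "(?H #>\<^bsub>?G\<^esub> z) [^]\<^bsub>?G Mod ?H\<^esub> n = (\<lambda>h. h + frag_cmul (int n) z) ` ?H" for z n
  proof (induction n)
    case 0
    then show ?case by (simp add: FactGroup_def)
  next
    case (Suc n)
    have "(?H #>\<^bsub>?G\<^esub> z) [^]\<^bsub>?G Mod ?H\<^esub> Suc n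
        = {x + y | x y. x \<in> (\<lambda>h. h + frag_cmul (int n) z) ` ?H \<and> y \<in> (\<lambda>h. h + z) ` ?H}"
      by (subst nat_pow_Suc, subst Suc, simp only: mult coset)
    also have "\<dots> = (\<lambda>h. h + frag_cmul (int (Suc n)) z) ` ?H"
    proof (intro equalityI subsetI)
      fix w assume "w \<in> {x + y | x y. x \<in> (\<lambda>h. h + frag_cmul (int n) z) ` ?H \<and> y \<in> (\<lambda>h. h + z) ` ?H}"
      then obtain h h' where h: "h \<in> ?H" "h' \<in> ?H" "w = (h + frag_cmul (int n) z) + (h' + z)" by blast
      then have "w = (h + h') + frag_cmul (int (Suc n)) z"
        by (simp add: frag_cmul_distrib algebra_simps)
      then show "w \<in> (\<lambda>h. h + frag_cmul (int (Suc n)) z) ` ?H" using Hadd[OF h(1,2)] by blast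
    next
      fix w assume "w \<in> (\<lambda>h. h + frag_cmul (int (Suc n)) z) ` ?H"
      then obtain h where "h \<in> ?H" "w = h + frag_cmul (int (Suc n)) z" by blast
      then have "w = (h + frag_cmul (int n) z) + (0 + z)"
        by (simp add: frag_cmul_distrib algebra_simps)
      with \<open>h \<in> ?H\<close> H0
      show "w \<in> {x + y | x y. x \<in> (\<lambda>h. h + frag_cmul (int n) z) ` ?H \<and> y \<in> (\<lambda>h. h + z) ` ?H}" by blast
    qed
    finally show ?case .
  qed
  show ?thesis
    unfolding torsion_free_def
  proof (intro ballI allI impI, elim conjE)
    fix X and m :: nat
    assume "X \<in> carrier (?G Mod ?H)" and m: "0 < m" "X [^]\<^bsub>?G Mod ?H\<^esub> m = \<one>\<^bsub>?G Mod ?H\<^esub>"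
    then obtain z where z: "z \<in> Z" "X = ?H #>\<^bsub>?G\<^esub> z"
      by (auto simp: FactGroup_def RCOSETS_def)
    have "(\<lambda>h. h + frag_cmul (int m) z) ` ?H = ?H"
      using m(2) pow[of z m] z by (simp add: FactGroup_def)
    then have "frag_cmul (int m) z \<in> ?H" using H0 by (metis (no_types, lifting) add_0 image_eqI)
    then have zH: "z \<in> ?H" using sat z m by blast
    have "(\<lambda>h. h + z) ` ?H = ?H"
    proof (intro equalityI subsetI)
      fix h assume "h \<in> ?H"
      then have "h - z \<in> ?H" using zH by (rule Hdiff)
      then show "h \<in> (\<lambda>h. h + z) ` ?H" by (intro image_eqI[of _ _ "h - z"]) auto
    qed (use Hadd zH in auto)
    then show "X = \<one>\<^bsub>?G Mod ?H\<^esub>" unfolding z(2) coset by (simp add: FactGroup_def)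
  qed
qed

theorem theorem1p2:
  fixes D :: link_diagram
    and tr :: "nat \<Rightarrow> bool"
    and \<epsilon> :: "nat set \<Rightarrow> nat \<Rightarrow> int"
    and g :: enat
    and i j :: int
  assumes "is_link_diagram D"
    and "is_sign_assignment D tr \<epsilon>"
    and "mg_planar (state_graph_A D)"
    and "mg_girth (state_graph_A D) = g" and "2 \<le> g"
    and "- int (c_minus D) \<le> i"
    and "ereal (of_int i) \<le> - ereal (of_nat (c_minus D)) + ereal_of_enat g - 1"
  shows "torsion_free (Kh_odd D tr \<epsilon> i j)"
proof -
  \<comment> \<open>In homological degree i, the states have k crossings with a
    B-resolution.\<close>
  define k where "k = nat (i + int (c_minus D))"
  have ki: "int k = i + int (c_minus D)" using assms(6) by (simp add: k_def)
  \<comment> \<open>The upper bound on i says \<open>k \<le> g - 1\<close>; for infinite girth the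
    claim is immediate.\<close>
  have "enat k < g"
  proof (cases g)
    case (enat n)
    then have "real_of_int i \<le> - real (c_minus D) + real n - 1"
      using assms(7) by (simp add: one_ereal_def)
    then have "real k < real n" using ki by linarith
    then show ?thesis using enat by simp
  qed simp
  then have k: "enat k < mg_girth (state_graph_A D)" using assms(4) by simp
  show ?thesis
    unfolding Kh_odd_def CKh_odd_def
  proof (rule torsion_free_quotient[OF d_odd_diff], fold CKh_odd_def)
    fix c m
    assume c: "c \<in> {c \<in> carrier (CKh_odd D i j). d_odd D tr \<epsilon> c = 0}" and m: "0 < (m :: nat)"
      and mc: "frag_cmul (int m) c \<in> d_odd D tr \<epsilon> ` carrier (CKh_odd D (i - 1) j)"
    then obtain b where "b \<in> carrier (CKh_odd D (i - 1) j)" "frag_cmul (int m) c = d_odd D tr \<epsilon> b"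
      by blast
    then show "c \<in> d_odd D tr \<epsilon> ` carrier (CKh_odd D (i - 1) j)"
      using d_odd_image_saturated[OF assms(1,2) k ki _ _ _, of c j b "int m"] c m by auto
  qed
qed

end
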